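(* Let $N\ge2$. Let $\mathbf L$ be the $N\times N$ matrix whose only nonzero entries are $\mathbf L_{i,i+1}=D-\Lambda_i(z)$ for $i=1,\dots,N-1$ and $\mathbf L_{N,1}=D-\Lambda_N(z)$, and let $\mathbf P=\operatorname{diag}(P_1,\dots,P_N)$ be the associated diagonal matrix commuting with $\mathbf L$, where $P_i=(L_i)^{1/N}$. For $n\ge1$ let $\mathbf H_n=\frac1n\int\operatorname{Tr}\operatorname{Res}\mathbf P^n$. Then the equation $\partial_{t_n}\mathbf L=[\mathbf L,(\mathbf P^n)_+]$ can be represented in hamiltonian form as $$\partial_{t_n}\Lambda_i(z)=\{\Lambda_i(z),\mathbf H_n\},\qquad i=1,\dots,N,$$ and the hamiltonians commute with each other: $\{\mathbf H_n,\mathbf H_m\}=0$ for all $n,m\ge1$.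
   Context: $q\in\mathbb C^\times$ is generic (in particular not a root of unity), and $D$ is the $q$-shift $[D\cdot f](z)=f(zq)$, so $D\,f(z)=f(zq)\,D$ as operators. $\Lambda_i(z)=\sum_{m\in\mathbb Z}\Lambda_i[m]z^{-m}$, $i=1,\dots,N$, are formal Laurent series with independent coefficients; indices are taken modulo $N$. Ring $\mathcal J_{q,N}$: the smallest ring with $D$-action containing $\mathbb C[\Lambda_i(zq^j)]_{1\le i\le N,\,j\in\mathbb Z}$ on which $1+D+\dots+D^{N-1}$ is invertible (obtained by iteratively adjoining solutions $f$ of $(1+D+\dots+D^{N-1})f=R$). $\int R$ denotes the $0$th Fourier coefficient $R[0]$ of $R(z)=\sum_mR[m]z^{-m}\in\mathcal J_{q,N}$, a (possibly infinite) series in the variables $\Lambda_i[m]$. $\mathcal I_{q,N}$ is the ring of operators $\sum_{n\le M}J_nD^n$, $J_n\in\mathcal J_{q,N}$ (infinitely many negative powers allowed). For $R=\sum R_nD^n$: $R_+=\sum_{n\ge0}R_nD^n$ and $\operatorname{Res}R=R_0$ (applied entrywise to matrices). $L_i=(D-\Lambda_i(z))(D-\Lambda_{i+1}(z))\cdots(D-\Lambda_{i+N-1}(z))$, and $P_i=(L_i)^{1/N}\in\mathcal I_{q,N}$ is the unique element of the form $D+\sum_{m\ge0}P_i^{[m]}D^{-m}$ with $P_i^N=L_i$; then $\mathbf P\mathbf L=\mathbf L\mathbf P$ and $\mathbf P^N=\mathbf L^N$. The equation $\partial_{t_n}\mathbf L=[\mathbf L,(\mathbf P^n)_+]$, read entrywise,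 defines $\partial_{t_n}\Lambda_i(z)$ (the right side has the same matrix shape as $\mathbf L$ with entries of order $0$ in $D$). Poisson bracket: with all $m=0$ coefficients understood as limiting values (here $0$), $$\{\Lambda_i(z),\Lambda_i(w)\}=\sum_{m\in\mathbb Z}\Big(\frac wz\Big)^m\frac{(1-q^m)(1-q^{m(N-1)})}{1-q^{mN}}\Lambda_i(z)\Lambda_i(w),$$ $$\{\Lambda_i(z),\Lambda_j(w)\}=-\sum_{m\in\mathbb Z}\Big(\frac{wq^{N+i-j-1}}{z}\Big)^m\frac{(1-q^m)^2}{1-q^{mN}}\Lambda_i(z)\Lambda_j(w),\quad 1\le i<j\le N,$$ extended by antisymmetry, bilinearity and the Leibniz rule. *)

theory Defs
  imports Complex_Main "HOL-Library.Multiset" "HOL-Library.Groups_Big_Fun"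
begin

section \<open>Series in the Fourier coefficients\<close>

text \<open>
  The pair \<open>(i, m)\<close> stands for the variable \<open>\<Lambda>\<^sub>i[m]\<close>, a multiset of such pairs for a monomial, and
  an element of type \<open>lser\<close> is a (possibly infinite) complex series of monomials.

  The same type represents formal Laurent series in \<open>z\<close>. In every element
  \<open>R(z) = \<Sum>\<^sub>m R[m] z\<^sup>-\<^sup>m\<close> of the ring generated by the \<open>\<Lambda>\<^sub>i(z q\<^sup>j)\<close>, and hence of
  the ring \<open>J_ring\<close> below, the coefficient \<open>R[m]\<close> contains only monomials
  \<open>\<Lambda>\<^bsub>i\<^sub>1\<^esub>[m\<^sub>1] \<cdots> \<Lambda>\<^bsub>i\<^sub>r\<^esub>[m\<^sub>r]\<close> of weight \<open>m\<^sub>1 + \<cdots> + m\<^sub>r = m\<close>. The power of \<open>z\<close> can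
  therefore be read off from the monomial: \<open>R(z)\<close> is represented by the single series \<open>\<Sum>\<^sub>m R[m]\<close>,
  and \<open>R[m]\<close> is recovered as its part \<open>mode m R\<close> of weight \<open>m\<close>. The lemmas \<open>mode_mult\<close>,
  \<open>mode_shift\<close> and \<open>mode_Lam\<close> show that product, \<open>q\<close>-shift and generators are the intended ones.
\<close>

type_synonym var = "nat \<times> int"

typedef lser = "UNIV :: (var multiset \<Rightarrow> complex) set"
  morphisms coeff Lser by simp

setup_lifting type_definition_lser

lemma lser_eqI: "(\<And>\<mu>. coeff f \<mu> = coeff g \<mu>) \<Longrightarrow> f = g"
  by transfer auto

lemma finite_msplit [simp]: "finite {(\<alpha>, \<beta>). \<alpha> + \<beta> = (\<mu> :: 'a multiset)}"
proof (induction \<mu>)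
  case empty
  have "{(\<alpha>, \<beta>). \<alpha> + \<beta> = ({#} :: 'a multiset)} \<subseteq> {({#}, {#})}" by auto
  then show ?case using finite_subset by blast
next
  case (add x \<mu>)
  let ?S = "{(\<alpha>, \<beta>). \<alpha> + \<beta> = \<mu>}"
  have "{(\<alpha>, \<beta>). \<alpha> + \<beta> = add_mset x \<mu>}
    \<subseteq> (\<lambda>(\<alpha>, \<beta>). (add_mset x \<alpha>, \<beta>)) ` ?S \<union> (\<lambda>(\<alpha>, \<beta>). (\<alpha>, add_mset x \<beta>)) ` ?S"
  proof clarify
    fix \<alpha> \<beta> assume eq: "\<alpha> + \<beta> = add_mset x \<mu>" and n: "(\<alpha>, \<beta>) \<notin> (\<lambda>(\<alpha>, \<beta>). (\<alpha>, add_mset x \<beta>)) ` ?S"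
    have "x \<in># \<alpha> + \<beta>" by (simp add: eq)
    then consider "x \<in># \<alpha>" | "x \<in># \<beta>" by auto
    then show "(\<alpha>, \<beta>) \<in> (\<lambda>(\<alpha>, \<beta>). (add_mset x \<alpha>, \<beta>)) ` ?S"
    proof cases
      case 1
      then obtain \<alpha>' where "\<alpha> = add_mset x \<alpha>'" by (metis mset_add)
      then show ?thesis using eq by (auto intro!: image_eqI[of _ _ "(\<alpha>', \<beta>)"])
    next
      case 2
      then obtain \<beta>' where "\<beta> = add_mset x \<beta>'" by (metis mset_add)
      then show ?thesis using eq n by (auto simp: image_iff)
    qed
  qed
  then show ?case using add finite_subset by blast
qed

instantiation lser :: comm_ring_1
begin

lift_definition zero_lser :: lser is "\<lambda>_. 0" .
lift_definition one_lser :: lser is "\<lambda>\<mu>. if \<mu> = {#} then 1 else 0" .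
lift_definition plus_lser :: "lser \<Rightarrow> lser \<Rightarrow> lser" is "\<lambda>f g \<mu>. f \<mu> + g \<mu>" .
lift_definition uminus_lser :: "lser \<Rightarrow> lser" is "\<lambda>f \<mu>. - f \<mu>" .
lift_definition minus_lser :: "lser \<Rightarrow> lser \<Rightarrow> lser" is "\<lambda>f g \<mu>. f \<mu> - g \<mu>" .
lift_definition times_lser :: "lser \<Rightarrow> lser \<Rightarrow> lser"
  is "\<lambda>f g \<mu>. \<Sum>(\<alpha>, \<beta>) | \<alpha> + \<beta> = \<mu>. f \<alpha> * g \<beta>" .

instance
proof
  fix f g h :: lser
  show "f * g * h = f * (g * h)"
  proof (transfer, rule ext)
    fix f g h :: "var multiset \<Rightarrow> complex" and \<mu> :: "var multiset"
    have "(\<Sum>(\<alpha>, \<beta>) | \<alpha> + \<beta> = \<mu>. (\<Sum>(\<gamma>, \<delta>) | \<gamma> + \<delta> = \<alpha>. f \<gamma> * g \<delta>) * h \<beta>) =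
      (\<Sum>p | fst p + snd p = \<mu>. \<Sum>r | fst r + snd r = fst p. f (fst r) * g (snd r) * h (snd p))"
      by (simp add: sum_distrib_right case_prod_unfold)
    also have "\<dots> = (\<Sum>(p, r) \<in> Sigma {p. fst p + snd p = \<mu>} (\<lambda>p. {r. fst r + snd r = fst p}).
       f (fst r) * g (snd r) * h (snd p))"
      using finite_msplit by (intro sum.Sigma) (auto simp: case_prod_unfold)
    also have "\<dots> = (\<Sum>(p, r) \<in> Sigma {p. fst p + snd p = \<mu>} (\<lambda>p. {r. fst r + snd r = snd p}).
       f (fst p) * (g (fst r) * h (snd r)))"
      by (rule sum.reindex_bij_witness[where
            j = "\<lambda>(p, r). ((fst r, snd r + snd p), (snd r, snd p))" and
            i = "\<lambda>(p, r). ((fst p + fst r, snd r), (fst p, fst r))"])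
         (auto simp: add.assoc mult.assoc)
    also have "\<dots> = (\<Sum>p | fst p + snd p = \<mu>. \<Sum>r | fst r + snd r = snd p. f (fst p) * (g (fst r) * h (snd r)))"
      using finite_msplit by (intro sum.Sigma[symmetric]) (auto simp: case_prod_unfold)
    also have "\<dots> = (\<Sum>(\<alpha>, \<beta>) | \<alpha> + \<beta> = \<mu>. f \<alpha> * (\<Sum>(\<gamma>, \<delta>) | \<gamma> + \<delta> = \<beta>. g \<gamma> * h \<delta>))"
      by (simp add: sum_distrib_left case_prod_unfold)
    finally show "(\<Sum>(\<alpha>, \<beta>) | \<alpha> + \<beta> = \<mu>. (\<Sum>(\<gamma>, \<delta>) | \<gamma> + \<delta> = \<alpha>. f \<gamma> * g \<delta>) * h \<beta>) =
      (\<Sum>(\<alpha>, \<beta>) | \<alpha> + \<beta> = \<mu>. f \<alpha> * (\<Sum>(\<gamma>, \<delta>) | \<gamma> + \<delta> = \<beta>. g \<gamma> * h \<delta>))" .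
  qed
  show "f * g = g * f"
    by (transfer, rule ext, rule sum.reindex_bij_witness[where i = prod.swap and j = prod.swap])
       (auto simp: add.commute mult.commute)
  show "1 * f = f"
  proof (transfer, rule ext)
    fix f :: "var multiset \<Rightarrow> complex" and \<mu> :: "var multiset"
    have "(\<Sum>(\<alpha>, \<beta>) | \<alpha> + \<beta> = \<mu>. (if \<alpha> = {#} then 1 else 0) * f \<beta>) =
      (\<Sum>(\<alpha>, \<beta>) \<in> {({#} :: var multiset, \<mu>)}. (if \<alpha> = {#} then 1 else 0) * f \<beta>)"
      by (rule sum.mono_neutral_right) (auto split: if_splits)
    then show "(\<Sum>(\<alpha>, \<beta>) | \<alpha> + \<beta> = \<mu>. (if \<alpha> = {#} then 1 else 0) * f \<beta>) = f \<mu>" by simp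
  qed
  show "(f + g) * h = f * h + g * h"
    by transfer (simp add: distrib_right sum.distrib case_prod_beta)
  show "(0 :: lser) \<noteq> 1" by transfer (metis zero_neq_one)
qed (transfer; simp add: add.assoc add.commute fun_eq_iff)+

end

lift_definition Const :: "complex \<Rightarrow> lser" is "\<lambda>c \<mu>. if \<mu> = {#} then c else 0" .

lift_definition Var :: "var \<Rightarrow> lser" is "\<lambda>x \<mu>. if \<mu> = {#x#} then 1 else 0" .

text \<open>Sum of a family that is locally finite, i.e. each monomial occurs in finitely many members.\<close>

lift_definition lfsum :: "('a \<Rightarrow> lser) \<Rightarrow> lser" is "\<lambda>f \<mu>. Sum_any (\<lambda>x. f x \<mu>)" .

lift_definition pderiv :: "var \<Rightarrow> lser \<Rightarrow> lser"
  is "\<lambda>x f \<mu>. of_nat (Suc (count \<mu> x)) * f (add_mset x \<mu>)" .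

definition weight :: "var multiset \<Rightarrow> int" where
  "weight \<mu> = (\<Sum>x\<in>#\<mu>. snd x)"

lift_definition mode :: "int \<Rightarrow> lser \<Rightarrow> lser"
  is "\<lambda>m f \<mu>. if weight \<mu> = m then f \<mu> else 0" .

text \<open>\<open>shift q k\<close> is \<open>D\<^sup>k\<close>, that is \<open>R(z) \<mapsto> R(z q\<^sup>k)\<close>; it multiplies \<open>R[m]\<close> by \<open>q\<^sup>-\<^sup>k\<^sup>m\<close>.\<close>

lift_definition shift :: "complex \<Rightarrow> int \<Rightarrow> lser \<Rightarrow> lser"
  is "\<lambda>q k f \<mu>. q powi (- k * weight \<mu>) * f \<mu>" .

definition Lam :: "nat \<Rightarrow> lser" where
  "Lam i = lfsum (\<lambda>m. Var (i, m))"

lemma weight_add: "weight (\<alpha> + \<beta>) = weight \<alpha> + weight \<beta>"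
  by (simp add: weight_def)

lemma mode_eqI: "(\<And>m. mode m f = mode m g) \<Longrightarrow> f = g"
  by transfer (metis ext)

lemma mode_Lam: "mode m (Lam i) = Var (i, m)"
proof (rule lser_eqI)
  fix \<mu>
  show "coeff (mode m (Lam i)) \<mu> = coeff (Var (i, m)) \<mu>"
  proof (cases "weight \<mu> = m")
    case True
    have eq: "coeff (Var (i, k)) \<mu> = (if k = m then coeff (Var (i, m)) \<mu> else 0)" for k
      using True by (auto simp: weight_def Var.rep_eq)
    have "Sum_any (\<lambda>k. coeff (Var (i, k)) \<mu>) = Sum_any (\<lambda>k. if k = m then coeff (Var (i, m)) \<mu> else 0)"
      using eq by (rule Sum_any.cong)
    then show ?thesis using True by (simp add: Lam_def mode.rep_eq lfsum.rep_eq)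
  qed (auto simp: mode.rep_eq Var.rep_eq weight_def)
qed

lemma mode_shift: "mode m (shift q k R) = Const (q powi (- k * m)) * mode m R"
proof (rule lser_eqI)
  fix \<mu>
  have "coeff (Const c * f) \<mu> = c * coeff f \<mu>" for c f
  proof -
    have "coeff (Const c * f) \<mu> = (\<Sum>(\<alpha>, \<beta>) \<in> {({#} :: var multiset, \<mu>)}. (if \<alpha> = {#} then c else 0) * coeff f \<beta>)"
      unfolding times_lser.rep_eq Const.rep_eq by (rule sum.mono_neutral_right) (auto split: if_splits)
    then show ?thesis by simp
  qed
  then show "coeff (mode m (shift q k R)) \<mu> = coeff (Const (q powi (- k * m)) * mode m R) \<mu>"
    by (simp add: mode.rep_eq shift.rep_eq)
qed

lemma mode_mult: "mode m (R * S) = lfsum (\<lambda>k. mode k R * mode (m - k) S)"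
proof (rule lser_eqI)
  fix \<mu>
  let ?A = "{(\<alpha>, \<beta>). \<alpha> + \<beta> = \<mu>} :: (var multiset \<times> var multiset) set"
  let ?W = "weight ` fst ` ?A"
  let ?t = "\<lambda>k (\<alpha>, \<beta>). (if weight \<alpha> = k then coeff R \<alpha> else 0) * (if weight \<beta> = m - k then coeff S \<beta> else 0)"
  have W: "finite ?W" by (intro finite_imageI finite_msplit)
  have "coeff (lfsum (\<lambda>k. mode k R * mode (m - k) S)) \<mu> = Sum_any (\<lambda>k. sum (?t k) ?A)"
    by (simp add: lfsum.rep_eq times_lser.rep_eq mode.rep_eq)
  also have "\<dots> = (\<Sum>k\<in>?W. sum (?t k) ?A)"
  proof (rule Sum_any.expand_superset[OF W], clarify)
    fix k assume ne: "sum (?t k) ?A \<noteq> 0"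
    obtain p where "p \<in> ?A" "?t k p \<noteq> 0" using ne by (metis (no_types, lifting) sum.neutral)
    then show "k \<in> ?W" by (auto split: if_splits intro!: image_eqI)
  qed
  also have "\<dots> = (\<Sum>p\<in>?A. \<Sum>k\<in>?W. ?t k p)" by (rule sum.swap)
  also have "\<dots> = (\<Sum>(\<alpha>, \<beta>)\<in>?A. if weight \<mu> = m then coeff R \<alpha> * coeff S \<beta> else 0)"
  proof (rule sum.cong[OF refl])
    fix p assume "p \<in> ?A"
    moreover obtain \<alpha> \<beta> where p: "p = (\<alpha>, \<beta>)" by fastforce
    ultimately have mu: "\<mu> = \<alpha> + \<beta>" by auto
    have "(\<Sum>k\<in>?W. ?t k (\<alpha>, \<beta>)) = (\<Sum>k\<in>{weight \<alpha>}. ?t k (\<alpha>, \<beta>))"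
      by (rule sum.mono_neutral_right[OF W]) (auto simp: mu intro!: image_eqI)
    also have "\<dots> = (if weight (\<alpha> + \<beta>) = m then coeff R \<alpha> * coeff S \<beta> else 0)"
      by (auto simp: weight_add)
    finally show "(\<Sum>k\<in>?W. ?t k p) = (case p of (\<alpha>, \<beta>) \<Rightarrow> if weight \<mu> = m then coeff R \<alpha> * coeff S \<beta> else 0)"
      by (simp add: mu p)
  qed
  also have "\<dots> = coeff (mode m (R * S)) \<mu>"
    by (simp add: mode.rep_eq times_lser.rep_eq case_prod_beta)
  finally show "coeff (mode m (R * S)) \<mu> = coeff (lfsum (\<lambda>k. mode k R * mode (m - k) S)) \<mu>" ..
qed


section \<open>The rings of functions and of operators\<close>

text \<open>
  For \<open>q\<close> not a root of unity, \<open>1 + D + \<cdots> + D\<^sup>N\<^sup>-\<^sup>1\<close> is bijective on \<open>lser\<close> (it multiplies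
  \<open>R[m]\<close> by a nonzero number), so adjoining the solutions of \<open>(1 + D + \<cdots> + D\<^sup>N\<^sup>-\<^sup>1) f = R\<close> amounts to
  the rule \<open>J_solve\<close>.
\<close>

inductive_set J_ring :: "complex \<Rightarrow> nat \<Rightarrow> lser set" for q N where
  J_const: "Const c \<in> J_ring q N"
| J_Lam: "i \<in> {1..N} \<Longrightarrow> Lam i \<in> J_ring q N"
| J_add: "R \<in> J_ring q N \<Longrightarrow> S \<in> J_ring q N \<Longrightarrow> R + S \<in> J_ring q N"
| J_mult: "R \<in> J_ring q N \<Longrightarrow> S \<in> J_ring q N \<Longrightarrow> R * S \<in> J_ring q N"
| J_shift: "R \<in> J_ring q N \<Longrightarrow> shift q k R \<in> J_ring q N"
| J_solve: "(\<Sum>k<N. shift q (int k) f) \<in> J_ring q N \<Longrightarrow> f \<in> J_ring q N"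

text \<open>\<open>R :: qop\<close> is the operator \<open>\<Sum>\<^sub>n R\<^sub>n D\<^sup>n\<close>, with \<open>R n\<close> standing for \<open>R\<^sub>n\<close>.\<close>

type_synonym qop = "int \<Rightarrow> lser"

definition I_ring :: "complex \<Rightarrow> nat \<Rightarrow> qop set" where
  "I_ring q N = {R. (\<forall>n. R n \<in> J_ring q N) \<and> (\<exists>M. \<forall>n>M. R n = 0)}"

text \<open>From \<open>R\<^sub>k D\<^sup>k \<cdot> S\<^sub>l D\<^sup>l = R\<^sub>k D\<^sup>k(S\<^sub>l) D\<^sup>k\<^sup>+\<^sup>l\<close>; the sum is finite for operators of bounded order.\<close>

definition op_mult :: "complex \<Rightarrow> qop \<Rightarrow> qop \<Rightarrow> qop" where
  "op_mult q R S = (\<lambda>n. Sum_any (\<lambda>k. R k * shift q k (S (n - k))))"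

definition op_fun :: "lser \<Rightarrow> qop" where
  "op_fun f = (\<lambda>n. if n = 0 then f else 0)"

definition op_pow :: "complex \<Rightarrow> qop \<Rightarrow> nat \<Rightarrow> qop" where
  "op_pow q R n = (op_mult q R ^^ n) (op_fun 1)"

definition op_pos :: "qop \<Rightarrow> qop" where
  "op_pos R = (\<lambda>n. if n \<ge> 0 then R n else 0)"

definition op_Res :: "qop \<Rightarrow> lser" where
  "op_Res R = R 0"

definition D_minus_Lam :: "nat \<Rightarrow> qop" where
  "D_minus_Lam i = (\<lambda>n. if n = 1 then 1 else if n = 0 then - Lam i else 0)"

text \<open>Representative in \<open>{1..N}\<close> of an index modulo \<open>N\<close>.\<close>

definition cyc :: "nat \<Rightarrow> nat \<Rightarrow> nat" where
  "cyc N i = (if i mod N = 0 then N else i mod N)"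

definition Lop :: "complex \<Rightarrow> nat \<Rightarrow> nat \<Rightarrow> qop" where
  "Lop q N i = foldr (\<lambda>k. op_mult q (D_minus_Lam (cyc N (i + k)))) [0..<N] (op_fun 1)"

definition Pop :: "complex \<Rightarrow> nat \<Rightarrow> nat \<Rightarrow> qop" where
  "Pop q N i = (THE P. P \<in> I_ring q N \<and> P 1 = 1 \<and> (\<forall>n>1. P n = 0) \<and> op_pow q P N = Lop q N i)"


section \<open>Matrices of operators\<close>

text \<open>Only the entries with both indices in \<open>{1..N}\<close> are meaningful.\<close>

type_synonym qmat = "nat \<Rightarrow> nat \<Rightarrow> qop"

definition mat_mult :: "complex \<Rightarrow> nat \<Rightarrow> qmat \<Rightarrow> qmat \<Rightarrow> qmat" where
  "mat_mult q N A B = (\<lambda>i j n. \<Sum>k\<in>{1..N}. op_mult q (A i k) (B k j) n)"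

definition mat_diag :: "(nat \<Rightarrow> qop) \<Rightarrow> qmat" where
  "mat_diag d = (\<lambda>i j. if i = j then d i else op_fun 0)"

definition mat_pow :: "complex \<Rightarrow> nat \<Rightarrow> qmat \<Rightarrow> nat \<Rightarrow> qmat" where
  "mat_pow q N A n = (mat_mult q N A ^^ n) (mat_diag (\<lambda>_. op_fun 1))"

definition mat_commutator :: "complex \<Rightarrow> nat \<Rightarrow> qmat \<Rightarrow> qmat \<Rightarrow> qmat" where
  "mat_commutator q N A B = (\<lambda>i j n. mat_mult q N A B i j n - mat_mult q N B A i j n)"

definition mat_pos :: "qmat \<Rightarrow> qmat" where
  "mat_pos A = (\<lambda>i j. op_pos (A i j))"

definition mat_trace_Res :: "nat \<Rightarrow> qmat \<Rightarrow> lser" where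
  "mat_trace_Res N A = (\<Sum>i\<in>{1..N}. op_Res (A i i))"

definition mat_eq :: "nat \<Rightarrow> qmat \<Rightarrow> qmat \<Rightarrow> bool" where
  "mat_eq N A B \<longleftrightarrow> (\<forall>i\<in>{1..N}. \<forall>j\<in>{1..N}. A i j = B i j)"

definition Lmat :: "nat \<Rightarrow> qmat" where
  "Lmat N = (\<lambda>i j. if j = cyc N (i + 1) then D_minus_Lam i else op_fun 0)"

text \<open>\<open>\<partial>L\<close> for a time derivative with \<open>\<partial>\<Lambda>\<^sub>i(z) = u\<^sub>i(z)\<close>.\<close>

definition dLmat :: "nat \<Rightarrow> (nat \<Rightarrow> lser) \<Rightarrow> qmat" where
  "dLmat N u = (\<lambda>i j. if j = cyc N (i + 1) then op_fun (- u i) else op_fun 0)"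

definition Pmat :: "complex \<Rightarrow> nat \<Rightarrow> qmat" where
  "Pmat q N = mat_diag (Pop q N)"

definition Ham :: "complex \<Rightarrow> nat \<Rightarrow> nat \<Rightarrow> lser" where
  "Ham q N n = Const (1 / of_nat n) * mode 0 (mat_trace_Res N (mat_pow q N (Pmat q N) n))"


section \<open>The Poisson bracket\<close>

text \<open>
  With \<open>{\<Lambda>\<^sub>i(z), \<Lambda>\<^sub>j(w)} = \<Sum>\<^sub>m \<kappa>\<^sub>i\<^sub>j(m) (w/z)\<^sup>m \<Lambda>\<^sub>i(z) \<Lambda>\<^sub>j(w)\<close>, the coefficient of \<open>z\<^sup>-\<^sup>a w\<^sup>-\<^sup>b\<close> is
  \<open>{\<Lambda>\<^sub>i[a], \<Lambda>\<^sub>j[b]} = \<Sum>\<^sub>m \<kappa>\<^sub>i\<^sub>j(m) \<Lambda>\<^sub>i[a - m] \<Lambda>\<^sub>j[b + m]\<close>.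
\<close>

definition kernel :: "complex \<Rightarrow> nat \<Rightarrow> nat \<Rightarrow> nat \<Rightarrow> int \<Rightarrow> complex" where
  "kernel q N i j m =
    (if m = 0 then 0
     else if i = j then (1 - q powi m) * (1 - q powi (m * (int N - 1))) / (1 - q powi (m * int N))
     else - (q powi (m * (int N + int i - int j - 1)) * (1 - q powi m)\<^sup>2 / (1 - q powi (m * int N))))"

definition var_bracket_le :: "complex \<Rightarrow> nat \<Rightarrow> var \<Rightarrow> var \<Rightarrow> lser" where
  "var_bracket_le q N = (\<lambda>(i, a) (j, b).
     lfsum (\<lambda>m. Const (kernel q N i j m) * (Var (i, a - m) * Var (j, b + m))))"

definition var_bracket :: "complex \<Rightarrow> nat \<Rightarrow> var \<Rightarrow> var \<Rightarrow> lser" where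
  "var_bracket q N x y =
    (if fst x \<le> fst y then var_bracket_le q N x y else - var_bracket_le q N y x)"

text \<open>
  The biderivation extending the bracket of the variables. The sum is locally finite whenever both
  arguments are homogeneous, see \<open>bracket_locally_finite\<close>; the bracket is only used for such
  arguments (variables and Fourier coefficients).
\<close>

definition bracket :: "complex \<Rightarrow> nat \<Rightarrow> lser \<Rightarrow> lser \<Rightarrow> lser" where
  "bracket q N F G = lfsum (\<lambda>(x, y). pderiv x F * pderiv y G * var_bracket q N x y)"

lemma coeff_mult_nonzeroE:
  assumes "coeff (f * g) \<mu> \<noteq> 0"
  obtains \<alpha> \<beta> where "\<alpha> + \<beta> = \<mu>" "coeff f \<alpha> \<noteq> 0" "coeff g \<beta> \<noteq> 0"
proof -
  obtain p where "p \<in> {(\<alpha>, \<beta>). \<alpha> + \<beta> = \<mu>}" "(\<lambda>(\<alpha>, \<beta>). coeff f \<alpha> * coeff g \<beta>) p \<noteq> 0"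
    using assms unfolding times_lser.rep_eq by (metis (no_types, lifting) sum.neutral)
  then show ?thesis using that by auto
qed

lemma var_bracket_le_support:
  assumes "coeff (var_bracket_le q N x y) \<mu> \<noteq> 0"
  shows "fst x \<in> fst ` set_mset \<mu> \<and> fst y \<in> fst ` set_mset \<mu>"
proof -
  obtain i a j b where xy: "x = (i, a)" "y = (j, b)" by (metis prod.exhaust)
  obtain m where "coeff (Const (kernel q N i j m) * (Var (i, a - m) * Var (j, b + m))) \<mu> \<noteq> 0"
    using assms unfolding xy var_bracket_le_def prod.case lfsum.rep_eq
    by (rule Sum_any.not_neutral_obtains_not_neutral)
  then show ?thesis
    unfolding xy
    by (auto elim!: coeff_mult_nonzeroE simp: Const.rep_eq Var.rep_eq split: if_splits)
qed

lemma bracket_locally_finite: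
  assumes F: "mode w F = F" and G: "mode v G = G"
  shows "finite {(x, y). coeff (pderiv x F * pderiv y G * var_bracket q N x y) \<nu> \<noteq> 0}"
proof -
  let ?S = "fst ` {(\<alpha>, \<beta>). \<alpha> + \<beta> = \<nu>}" and ?K = "fst ` set_mset \<nu>"
  let ?X = "\<lambda>w. (\<lambda>(i, \<alpha>). (i, w - weight \<alpha>)) ` (?K \<times> ?S)"
  have fin: "finite (?X w)" for w
    by (intro finite_imageI finite_cartesian_product finite_msplit finite_set_mset)
  have *: "coeff F (add_mset x \<alpha>) = 0" if "mode w F = F" "snd x \<noteq> w - weight \<alpha>" for x \<alpha> w F
  proof -
    have "coeff (mode w F) (add_mset x \<alpha>) = 0" using that(2) by (auto simp: mode.rep_eq weight_def)
    then show ?thesis using that(1) by simp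
  qed
  have "{(x, y). coeff (pderiv x F * pderiv y G * var_bracket q N x y) \<nu> \<noteq> 0} \<subseteq> ?X w \<times> ?X v"
  proof clarify
    fix i a j b assume "coeff (pderiv (i, a) F * pderiv (j, b) G * var_bracket q N (i, a) (j, b)) \<nu> \<noteq> 0"
    then obtain \<alpha> \<beta> \<tau> where nu: "\<alpha> + \<beta> + \<tau> = \<nu>" and nz: "coeff (pderiv (i, a) F) \<alpha> \<noteq> 0"
      "coeff (pderiv (j, b) G) \<beta> \<noteq> 0" "coeff (var_bracket q N (i, a) (j, b)) \<tau> \<noteq> 0"
      by (auto elim!: coeff_mult_nonzeroE)
    have a: "a = w - weight \<alpha>" and b: "b = v - weight \<beta>"
      using nz *[OF F, of "(i, a)"] *[OF G, of "(j, b)"] by (auto simp: pderiv.rep_eq)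
    have "i \<in> fst ` set_mset \<tau> \<and> j \<in> fst ` set_mset \<tau>"
      using nz(3) var_bracket_le_support[of q N "(i, a)" "(j, b)" \<tau>]
        var_bracket_le_support[of q N "(j, b)" "(i, a)" \<tau>]
      by (auto simp: var_bracket_def uminus_lser.rep_eq split: if_splits)
    then have "i \<in> ?K" "j \<in> ?K" using nu by auto
    moreover have "(\<alpha>, \<beta> + \<tau>) \<in> {(\<alpha>, \<beta>). \<alpha> + \<beta> = \<nu>}" "(\<beta>, \<alpha> + \<tau>) \<in> {(\<alpha>, \<beta>). \<alpha> + \<beta> = \<nu>}"
      using nu by (auto simp: ac_simps)
    then have "\<alpha> \<in> ?S" "\<beta> \<in> ?S" by force+
    ultimately show "(i, a) \<in> ?X w \<and> (j, b) \<in> ?X v" using a b by auto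
  qed
  then show ?thesis by (rule finite_subset) (use fin in auto)
qed

lemma bracket_Var: "bracket q N (Var x) (Var y) = var_bracket q N x y"
proof (rule lser_eqI)
  fix \<mu>
  have pd: "pderiv u (Var x) = (if u = x then 1 else 0)" for u x
    by (rule lser_eqI) (auto simp: pderiv.rep_eq Var.rep_eq one_lser.rep_eq zero_lser.rep_eq)
  have "Sum_any (\<lambda>p. coeff (case p of (u, v) \<Rightarrow> pderiv u (Var x) * pderiv v (Var y) * var_bracket q N u v) \<mu>) =
      Sum_any (\<lambda>p. if p = (x, y) then coeff (var_bracket q N x y) \<mu> else 0)"
    by (rule Sum_any.cong) (auto simp: pd zero_lser.rep_eq split: if_splits)
  then show "coeff (bracket q N (Var x) (Var y)) \<mu> = coeff (var_bracket q N x y) \<mu>"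
    by (simp add: bracket_def lfsum.rep_eq)
qed

end

theory Submission
  imports Defs
begin

text \<open>
  Write \<open>a\<^sub>i = D - \<Lambda>\<^sub>i\<close>. Comparing leading coefficients, an \<open>N\<close>-th root of a monic
  operator of order \<open>N\<close> is unique, which also gives \<open>P\<^sub>i a\<^sub>i = a\<^sub>i P\<^sub>i\<^sub>+\<^sub>1\<close>. Hence the Lax equation reads
  \<open>\<partial>\<Lambda>\<^sub>i = \<Lambda>\<^sub>i (A\<^sub>i\<^sub>+\<^sub>1 - A\<^sub>i)\<close> with \<open>A\<^sub>i = Res P\<^sub>i\<^sup>n\<close>. Since \<open>\<integral> Res\<close> is a trace, the variation
  of \<open>H\<^sub>n\<close> is \<open>\<Sum>\<^sub>k \<integral> Res (X\<^sub>k \<delta>a\<^sub>k)\<close> with \<open>X\<^sub>k = a\<^sub>k\<^sup>-\<^sup>1 P\<^sub>k\<^sup>n\<close>. From \<open>a\<^sub>k X\<^sub>k = P\<^sub>k\<^sup>n\<close> and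
  \<open>X\<^sub>k a\<^sub>k = P\<^sub>k\<^sub>+\<^sub>1\<^sup>n\<close> the function \<open>g\<^sub>k = \<Lambda>\<^sub>k Res X\<^sub>k\<close> satisfies \<open>(D - 1) g\<^sub>k = A\<^sub>k - D A\<^sub>k\<^sub>+\<^sub>1\<close>,
  and the kernel of the Poisson bracket inverts exactly this relation: its sum against the \<open>g\<^sub>k\<close>
  telescopes to \<open>A\<^sub>i - A\<^sub>i\<^sub>+\<^sub>1\<close>. The bracket of \<open>H\<^sub>n\<close> and \<open>H\<^sub>m\<close> is the variation of
  \<open>H\<^sub>n\<close> along the \<open>m\<close>-th Lax flow, a telescoping cyclic sum of traces.
\<close>

section \<open>Skew Laurent series over a difference ring\<close>

text \<open>The last two axioms say that \<open>1 + D + ... + D^(n-1)\<close> is bijective; this is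
  what makes n-th roots of monic operators exist and be unique.\<close>

class difference_ring = comm_ring_1 +
  fixes sh :: "int \<Rightarrow> 'a \<Rightarrow> 'a"
  assumes sh_0 [simp]: "sh 0 x = x"
    and sh_sh [simp]: "sh k (sh l x) = sh (k + l) x"
    and sh_add: "sh k (x + y) = sh k x + sh k y"
    and sh_mult: "sh k (x * y) = sh k x * sh k y"
    and sh_1 [simp]: "sh k 1 = 1"
    and sh_solve: "0 < n \<Longrightarrow> \<exists>x. (\<Sum>l<n. sh (int l) x) = y"
    and sh_solve_unique: "0 < n \<Longrightarrow> (\<Sum>l<n. sh (int l) x) = 0 \<Longrightarrow> x = 0"
begin

lemma sh_zero [simp]: "sh k 0 = 0"
  using sh_add[of k 0 0] by simp

lemma sh_sum: "sh k (sum f A) = (\<Sum>x\<in>A. sh k (f x))"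
  by (induction A rule: infinite_finite_induct) (auto simp: sh_add)

end

text \<open>Formal operators in \<open>D\<close>. Infinitely many negative powers are allowed; the
  upper bound on the order makes every coefficient of a product a finite sum.\<close>

typedef (overloaded) 'a skew = "{R :: int \<Rightarrow> 'a::zero. \<exists>M. \<forall>n>M. R n = 0}"
  morphisms cf Skew
  by (rule exI[of _ "\<lambda>_. 0"]) auto

setup_lifting type_definition_skew

definition ord_le :: "int \<Rightarrow> 'a::zero skew \<Rightarrow> bool" where
  "ord_le M R \<longleftrightarrow> (\<forall>n>M. cf R n = 0)"

lemma ord_leE:
  obtains M where "ord_le M R"
  using cf[of R] unfolding ord_le_def by auto

lemma ord_leD: "ord_le M R \<Longrightarrow> M < n \<Longrightarrow> cf R n = 0"
  by (simp add: ord_le_def)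

lemma ord_le_mono: "ord_le M R \<Longrightarrow> M \<le> M' \<Longrightarrow> ord_le M' R"
  by (simp add: ord_le_def)

lemma skew_eqI: "(\<And>n. cf R n = cf S n) \<Longrightarrow> R = S"
  by (simp add: cf_inject[symmetric] fun_eq_iff)

lemma skew_product_support:
  fixes r s :: "int \<Rightarrow> 'a::difference_ring"
  assumes "\<forall>n>a. r n = 0" and "\<forall>n>b. s n = 0"
  shows "{k. r k * sh k (s (n - k)) \<noteq> 0} \<subseteq> {n - b..a}"
proof
  fix k assume "k \<in> {k. r k * sh k (s (n - k)) \<noteq> 0}"
  then have "r k \<noteq> 0" "s (n - k) \<noteq> 0" by auto
  then have "\<not> k > a" "\<not> n - k > b" using assms by auto
  then show "k \<in> {n - b..a}" by auto
qed

instantiation skew :: (difference_ring) ring_1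
begin

lift_definition zero_skew :: "'a skew" is "\<lambda>_. 0" by auto
lift_definition one_skew :: "'a skew" is "\<lambda>n. if n = 0 then 1 else 0"
  by (auto intro!: exI[of _ 0])
lift_definition plus_skew :: "'a skew \<Rightarrow> 'a skew \<Rightarrow> 'a skew" is "\<lambda>r s n. r n + s n"
proof -
  fix r s :: "int \<Rightarrow> 'a" assume "\<exists>M. \<forall>n>M. r n = 0" "\<exists>M. \<forall>n>M. s n = 0"
  then obtain a b where "\<forall>n>a. r n = 0" "\<forall>n>b. s n = 0" by auto
  then show "\<exists>M. \<forall>n>M. r n + s n = 0" by (intro exI[of _ "max a b"]) auto
qed
lift_definition uminus_skew :: "'a skew \<Rightarrow> 'a skew" is "\<lambda>r n. - r n" by auto
lift_definition minus_skew :: "'a skew \<Rightarrow> 'a skew \<Rightarrow> 'a skew" is "\<lambda>r s n. r n - s n"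
proof -
  fix r s :: "int \<Rightarrow> 'a" assume "\<exists>M. \<forall>n>M. r n = 0" "\<exists>M. \<forall>n>M. s n = 0"
  then obtain a b where "\<forall>n>a. r n = 0" "\<forall>n>b. s n = 0" by auto
  then show "\<exists>M. \<forall>n>M. r n - s n = 0" by (intro exI[of _ "max a b"]) auto
qed
lift_definition times_skew :: "'a skew \<Rightarrow> 'a skew \<Rightarrow> 'a skew"
  is "\<lambda>r s n. Sum_any (\<lambda>k. r k * sh k (s (n - k)))"
proof -
  fix r s :: "int \<Rightarrow> 'a" assume "\<exists>M. \<forall>n>M. r n = 0" "\<exists>M. \<forall>n>M. s n = 0"
  then obtain a b where ab: "\<forall>n>a. r n = 0" "\<forall>n>b. s n = 0" by auto
  have "Sum_any (\<lambda>k. r k * sh k (s (n - k))) = 0" if "n > a + b" for n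
  proof -
    have "{k. r k * sh k (s (n - k)) \<noteq> 0} = {}"
      using skew_product_support[OF ab, of n] that by auto
    then show ?thesis by (simp add: Sum_any.expand_set)
  qed
  then show "\<exists>M. \<forall>n>M. Sum_any (\<lambda>k. r k * sh k (s (n - k))) = 0" by blast
qed

text \<open>The window may exceed the support on both sides, so that several products can be summed
  over one common range.\<close>

lemma cf_mult:
  fixes R S :: "'a skew"
  assumes "ord_le a R" "ord_le b S" "lo \<le> n - b" "a \<le> hi"
  shows "cf (R * S) n = (\<Sum>k\<in>{lo..hi}. cf R k * sh k (cf S (n - k)))"
  unfolding times_skew.rep_eq
proof (rule Sum_any.expand_superset)
  show "{k. cf R k * sh k (cf S (n - k)) \<noteq> 0} \<subseteq> {lo..hi}"
    using skew_product_support[of a "cf R" b "cf S" n] assms by (auto simp: ord_le_def)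
qed simp

lemma ord_le_mult:
  fixes R S :: "'a skew"
  assumes "ord_le a R" "ord_le b S"
  shows "ord_le (a + b) (R * S)"
  unfolding ord_le_def using cf_mult[OF assms order_refl order_refl] by auto

lemma skew_mult_assoc:
  fixes R S T :: "'a skew"
  shows "R * S * T = R * (S * T)"
proof (rule skew_eqI)
  fix n
  obtain a where R: "ord_le a R" by (rule ord_leE)
  obtain b where S: "ord_le b S" by (rule ord_leE)
  obtain c where T: "ord_le c T" by (rule ord_leE)
  \<comment> \<open>Chosen to contain the support of the inner product for every outer index, so
    that the two summations can be exchanged.\<close>
  let ?J = "{n - b - c..a}" and ?K = "{n - c..a + b}"
  have "cf (R * S * T) n = (\<Sum>k\<in>?K. cf (R * S) k * sh k (cf T (n - k)))"
    by (rule cf_mult[OF ord_le_mult[OF R S] T]) auto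
  also have "\<dots> = (\<Sum>k\<in>?K. \<Sum>j\<in>?J. cf R j * sh j (cf S (k - j)) * sh k (cf T (n - k)))"
    by (intro sum.cong[OF refl]) (subst cf_mult[OF R S, of "n - b - c" _ a], auto simp: sum_distrib_right)
  also have "\<dots> = (\<Sum>j\<in>?J. \<Sum>k\<in>?K. cf R j * sh j (cf S (k - j)) * sh k (cf T (n - k)))"
    by (rule sum.swap)
  also have "\<dots> = (\<Sum>j\<in>?J. cf R j * sh j (cf (S * T) (n - j)))"
  proof (rule sum.cong[OF refl])
    fix j assume j: "j \<in> ?J"
    have "cf (S * T) (n - j) = (\<Sum>l\<in>{n - c - j..a + b - j}. cf S l * sh l (cf T (n - j - l)))"
      using j by (intro cf_mult[OF S T]) auto
    also have "\<dots> = (\<Sum>k\<in>?K. cf S (k - j) * sh (k - j) (cf T (n - k)))"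
      by (rule sum.reindex_bij_witness[of _ "\<lambda>k. k - j" "\<lambda>l. l + j"]) (auto simp: algebra_simps)
    finally show "(\<Sum>k\<in>?K. cf R j * sh j (cf S (k - j)) * sh k (cf T (n - k))) =
      cf R j * sh j (cf (S * T) (n - j))"
      by (simp add: sh_sum sh_mult sum_distrib_left mult.assoc)
  qed
  also have "\<dots> = cf (R * (S * T)) n"
    by (rule cf_mult[OF R ord_le_mult[OF S T], symmetric]) auto
  finally show "cf (R * S * T) n = cf (R * (S * T)) n" .
qed

lemma skew_mult_add:
  fixes R S T :: "'a skew"
  shows "(R + S) * T = R * T + S * T" "R * (S + T) = R * S + R * T"
proof -
  obtain a where a: "ord_le a R" by (rule ord_leE)
  obtain b where b: "ord_le b S" by (rule ord_leE)
  obtain c where c: "ord_le c T" by (rule ord_leE)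
  define M where "M = max a (max b c)"
  have M: "ord_le M R" "ord_le M S" "ord_le M T"
    using a b c by (auto simp: M_def elim!: ord_le_mono)
  then have M': "ord_le M (R + S)" "ord_le M (S + T)" by (auto simp: ord_le_def plus_skew.rep_eq)
  show "(R + S) * T = R * T + S * T"
    by (rule skew_eqI)
       (simp add: plus_skew.rep_eq cf_mult[OF M'(1) M(3) order_refl order_refl]
         cf_mult[OF M(1) M(3) order_refl order_refl]
         cf_mult[OF M(2) M(3) order_refl order_refl] distrib_right sum.distrib)
  show "R * (S + T) = R * S + R * T"
    by (rule skew_eqI)
       (simp add: plus_skew.rep_eq cf_mult[OF M(1) M'(2) order_refl order_refl]
         cf_mult[OF M(1) M(2) order_refl order_refl]
         cf_mult[OF M(1) M(3) order_refl order_refl] sh_add distrib_left sum.distrib)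
qed

lemma skew_mult_one:
  fixes R :: "'a skew"
  shows "1 * R = R" "R * 1 = R"
proof -
  have "cf (1 * R) n = cf R n" for n
  proof -
    have "cf (1 * R) n = Sum_any (\<lambda>k::int. if k = 0 then cf R n else 0)"
      unfolding times_skew.rep_eq one_skew.rep_eq by (rule Sum_any.cong) simp
    then show ?thesis by simp
  qed
  then show "1 * R = R" by (rule skew_eqI)
  have "cf (R * 1) n = cf R n" for n
  proof -
    have "cf (R * 1) n = Sum_any (\<lambda>k. if k = n then cf R n else 0)"
      unfolding times_skew.rep_eq one_skew.rep_eq by (rule Sum_any.cong) simp
    then show ?thesis by simp
  qed
  then show "R * 1 = R" by (rule skew_eqI)
qed

instance
proof
  fix R S T :: "'a skew"
  show "R * S * T = R * (S * T)" by (rule skew_mult_assoc)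
  show "1 * R = R" "R * 1 = R" by (rule skew_mult_one)+
  show "(R + S) * T = R * T + S * T" "R * (S + T) = R * S + R * T" by (rule skew_mult_add)+
  show "(0 :: 'a skew) \<noteq> 1" by transfer (auto simp: fun_eq_iff)
qed (transfer; simp add: fun_eq_iff algebra_simps)+

end

lemmas cf_simps [simp] = zero_skew.rep_eq one_skew.rep_eq plus_skew.rep_eq uminus_skew.rep_eq
  minus_skew.rep_eq

lemma cf_sum: "cf (sum f A) n = (\<Sum>x\<in>A. cf (f x) n)"
  by (induction A rule: infinite_finite_induct) auto

lemma ord_le_add: "ord_le M R \<Longrightarrow> ord_le M S \<Longrightarrow> ord_le M (R + S)"
  by (simp add: ord_le_def)

lemma ord_le_sum: "(\<And>x. x \<in> A \<Longrightarrow> ord_le M (f x)) \<Longrightarrow> ord_le M (sum f A)"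
  by (simp add: ord_le_def cf_sum)

lemma cf_mult_top:
  assumes "ord_le a R" "ord_le b S"
  shows "cf (R * S) (a + b) = cf R a * sh a (cf S b)"
  by (subst cf_mult[OF assms, of a _ a]) auto

lift_definition monom :: "'a::zero \<Rightarrow> int \<Rightarrow> 'a skew" is "\<lambda>x k n. if n = k then x else 0"
  by (rule exI[of _ k for k]) auto

lemma cf_monom [simp]: "cf (monom x k) n = (if n = k then x else 0)"
  by (simp add: monom.rep_eq)

lemma ord_le_monom: "ord_le k (monom x k)"
  by (simp add: ord_le_def)

lemma cf_monom_mult: "cf (monom x k * R) n = x * sh k (cf R (n - k))"
proof -
  have "cf (monom x k * R) n = Sum_any (\<lambda>j. if j = k then x * sh k (cf R (n - k)) else 0)"
    unfolding times_skew.rep_eq by (rule Sum_any.cong) auto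
  then show ?thesis by simp
qed

lemma cf_mult_monom: "cf (R * monom x k) n = cf R (n - k) * sh (n - k) x"
proof -
  have "cf (R * monom x k) n = Sum_any (\<lambda>j. if j = n - k then cf R (n - k) * sh (n - k) x else 0)"
    unfolding times_skew.rep_eq by (rule Sum_any.cong) auto
  then show ?thesis by simp
qed

section \<open>Roots of monic operators: uniqueness and existence\<close>

definition monic :: "int \<Rightarrow> 'a::difference_ring skew \<Rightarrow> bool" where
  "monic d R \<longleftrightarrow> ord_le d R \<and> cf R d = 1"

lemma monic_mult: "monic a R \<Longrightarrow> monic b S \<Longrightarrow> monic (a + b) (R * S)"
  by (simp add: monic_def ord_le_mult cf_mult_top)

lemma monic_1: "monic 0 1"
  by (simp add: monic_def ord_le_def)

lemma monic_power: "monic 1 R \<Longrightarrow> monic (int n) (R ^ n)"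
  by (induction n) (auto simp: monic_1 dest: monic_mult)

text \<open>With \<open>W = P - Q\<close> the sum is \<open>P ^ n - Q ^ n\<close>. The monic factors
  contribute only shifts at the top order, so the top coefficient is
  \<open>1 + D + ... + D^(n-1)\<close> applied to that of \<open>W\<close>.\<close>

lemma sandwich_top:
  assumes P: "monic 1 P" and Q: "monic 1 Q" and W: "ord_le m W"
  shows "ord_le (m + int n - 1) (\<Sum>k<n. P ^ k * W * Q ^ (n - 1 - k))" (is ?th1)
    and "cf (\<Sum>k<n. P ^ k * W * Q ^ (n - 1 - k)) (m + int n - 1) = (\<Sum>k<n. sh (int k) (cf W m))"
proof -
  have *: "ord_le (m + int n - 1) (P ^ k * W * Q ^ (n - 1 - k)) \<and>
      cf (P ^ k * W * Q ^ (n - 1 - k)) (m + int n - 1) = sh (int k) (cf W m)" if k: "k < n" for k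
  proof -
    have Pk: "ord_le (int k) (P ^ k)" "cf (P ^ k) (int k) = 1"
      using monic_power[OF P, of k] by (auto simp: monic_def)
    have Qk: "ord_le (int (n - 1 - k)) (Q ^ (n - 1 - k))" "cf (Q ^ (n - 1 - k)) (int (n - 1 - k)) = 1"
      using monic_power[OF Q, of "n - 1 - k"] by (auto simp: monic_def)
    have eq: "m + int n - 1 = int k + m + int (n - 1 - k)" using k by auto
    show ?thesis
      unfolding eq using cf_mult_top[OF ord_le_mult[OF Pk(1) W] Qk(1)] cf_mult_top[OF Pk(1) W]
        ord_le_mult[OF ord_le_mult[OF Pk(1) W] Qk(1)] Pk(2) Qk(2) by simp
  qed
  show ?th1 using * by (intro ord_le_sum) auto
  show "cf (\<Sum>k<n. P ^ k * W * Q ^ (n - 1 - k)) (m + int n - 1) = (\<Sum>k<n. sh (int k) (cf W m))"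
    unfolding cf_sum using * by (intro sum.cong) auto
qed

text \<open>Descent on the order: the top coefficient of \<open>W\<close> is killed by
  \<open>1 + D + ... + D^(n-1)\<close>, hence vanishes, and the order bound drops by one each
  time.\<close>

lemma sandwich_eq_0:
  assumes P: "monic 1 P" and Q: "monic 1 Q" and n: "0 < n"
    and eq: "(\<Sum>k<n. P ^ k * W * Q ^ (n - 1 - k)) = 0"
  shows "W = 0"
proof -
  obtain M where M: "ord_le M W" by (rule ord_leE)
  have "ord_le (M - int j) W" for j
  proof (induction j)
    case (Suc j)
    have "(\<Sum>k<n. sh (int k) (cf W (M - int j))) = 0"
      using sandwich_top(2)[OF P Q Suc, of n] unfolding eq by simp
    then have "cf W (M - int j) = 0" by (rule sh_solve_unique[OF n])
    moreover have "n = M - int j \<or> n > M - int j" if "n > M - int (Suc j)" for n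
      using that by auto
    ultimately show ?case using Suc unfolding ord_le_def by blast
  qed (use M in simp)
  note W = this
  have "cf W n = 0" for n
  proof (rule ord_leD[OF W])
    show "M - int (nat (M - n + 1)) < n" by linarith
  qed
  then show ?thesis by (intro skew_eqI) simp
qed

text \<open>Noncommutative form of the factorisation of \<open>x ^ n - y ^ n\<close>, which is the
  case \<open>w = 1\<close>.\<close>

lemma power_intertwine:
  fixes x y w :: "'a::ring_1"
  shows "x ^ n * w - w * y ^ n = (\<Sum>k<n. x ^ k * (x * w - w * y) * y ^ (n - 1 - k))"
proof (induction n)
  case (Suc n)
  have "(\<Sum>k<Suc n. x ^ k * (x * w - w * y) * y ^ (Suc n - 1 - k)) =
    (\<Sum>k<n. x ^ k * (x * w - w * y) * y ^ (n - 1 - k)) * y + x ^ n * (x * w - w * y)"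
  proof -
    have "x ^ k * (x * w - w * y) * y ^ (n - k) = x ^ k * (x * w - w * y) * y ^ (n - 1 - k) * y"
      if "k < n" for k
    proof -
      have "n - k = Suc (n - 1 - k)" using that by simp
      then show ?thesis by (simp only: power_Suc2 mult.assoc)
    qed
    then show ?thesis by (simp add: sum_distrib_right)
  qed
  also have "\<dots> = (x ^ n * w - w * y ^ n) * y + x ^ n * (x * w - w * y)"
    by (simp only: Suc)
  also have "\<dots> = x ^ Suc n * w - w * y ^ Suc n"
    by (simp add: power_Suc2 algebra_simps del: power_Suc)
  finally show ?case by simp
qed simp

text \<open>The difference \<open>P * W - W * Q\<close> has vanishing sandwich sum. Taking
  \<open>W = 1\<close> yields uniqueness of roots, taking \<open>W = fac N i\<close> the relation
  between neighbouring roots.\<close>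

lemma root_intertwine:
  assumes "monic 1 P" "monic 1 Q" "0 < n" "P ^ n * W = W * Q ^ n"
  shows "P * W = W * Q"
  using sandwich_eq_0[OF assms(1-3), of "P * W - W * Q"] power_intertwine[of P n W Q] assms(4)
  by simp

text \<open>Closure under solving is the counterpart of \<open>J_solve\<close>; it keeps the root
  inside \<open>I_ring\<close>, where \<open>Pop\<close> seeks it.\<close>

definition difference_subring :: "nat \<Rightarrow> 'a::difference_ring set \<Rightarrow> bool" where
  "difference_subring n J \<longleftrightarrow> 1 \<in> J \<and> (\<forall>x\<in>J. \<forall>y\<in>J. x - y \<in> J \<and> x * y \<in> J) \<and>
     (\<forall>x\<in>J. \<forall>k. sh k x \<in> J) \<and> (\<forall>x. (\<Sum>k<n. sh (int k) x) \<in> J \<longrightarrow> x \<in> J)"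

lemma difference_subringD:
  assumes "difference_subring n J"
  shows "0 \<in> J" "1 \<in> J" "x \<in> J \<Longrightarrow> y \<in> J \<Longrightarrow> x - y \<in> J" "x \<in> J \<Longrightarrow> y \<in> J \<Longrightarrow> x + y \<in> J"
    "x \<in> J \<Longrightarrow> y \<in> J \<Longrightarrow> x * y \<in> J" "x \<in> J \<Longrightarrow> sh k x \<in> J"
    "(\<Sum>k<n. sh (int k) x) \<in> J \<Longrightarrow> x \<in> J"
proof -
  show 0: "0 \<in> J" using assms unfolding difference_subring_def by (metis diff_self)
  show "x \<in> J \<Longrightarrow> y \<in> J \<Longrightarrow> x + y \<in> J"
    using assms 0 unfolding difference_subring_def by (metis diff_0 diff_minus_eq_add)
qed (use assms in \<open>auto simp: difference_subring_def\<close>)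

definition coeffs_in :: "'a::zero set \<Rightarrow> 'a skew \<Rightarrow> bool" where
  "coeffs_in J R \<longleftrightarrow> (\<forall>n. cf R n \<in> J)"

lemma coeffs_in_mult:
  assumes J: "difference_subring N J" and "coeffs_in J R" "coeffs_in J S"
  shows "coeffs_in J (R * S)"
  unfolding coeffs_in_def
proof
  fix n
  obtain a where a: "ord_le a R" by (rule ord_leE)
  obtain b where b: "ord_le b S" by (rule ord_leE)
  note eq = cf_mult[OF a b order_refl order_refl, of n]
  have sumJ: "sum f A \<in> J" if "\<And>x. x \<in> A \<Longrightarrow> f x \<in> J" for f :: "int \<Rightarrow> 'a" and A
    using that by (induction A rule: infinite_finite_induct) (auto intro: difference_subringD(1-6)[OF J])
  show "cf (R * S) n \<in> J"
    unfolding eq using assms(2,3)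
    by (intro sumJ) (auto simp: coeffs_in_def intro!: difference_subringD(5,6)[OF J])
qed

lemma coeffs_in_1: "difference_subring N J \<Longrightarrow> coeffs_in J 1"
  by (simp add: coeffs_in_def difference_subringD)

lemma coeffs_in_power: "difference_subring N J \<Longrightarrow> coeffs_in J R \<Longrightarrow> coeffs_in J (R ^ n)"
  by (induction n) (auto intro: coeffs_in_mult coeffs_in_1)

text \<open>Successive approximation: adding \<open>d D^(-j)\<close> alters \<open>P ^ N\<close> at
  order \<open>N - 1 - j\<close> by \<open>d + D d + ... + D^(N-1) d\<close>, so \<open>d\<close>
  can be solved for to cancel the leading error.\<close>

lemma root_step:
  assumes J: "difference_subring N J" and N: "0 < N"
    and L: "coeffs_in J L"
    and P: "monic 1 P" "coeffs_in J P" "ord_le (int N - 1 - int j) (P ^ N - L)"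
  shows "\<exists>P'. monic 1 P' \<and> coeffs_in J P' \<and> ord_le (int N - 1 - int (Suc j)) (P' ^ N - L)
    \<and> ord_le (- int j) (P' - P)"
proof -
  let ?c = "cf (P ^ N - L) (int N - 1 - int j)"
  obtain d where d: "(\<Sum>k<N. sh (int k) d) = - ?c" using sh_solve[OF N] by blast
  define P' where "P' = P + monom d (- int j)"
  have "?c \<in> J" using coeffs_in_power[OF J P(2), of N] L
    by (auto simp: coeffs_in_def intro: difference_subringD(1-6)[OF J])
  then have "0 - ?c \<in> J" by (intro difference_subringD(1,3)[OF J])
  then have dJ: "d \<in> J" using d difference_subringD(7)[OF J] by simp
  have P'1: "monic 1 P'" using P(1) by (auto simp: monic_def P'_def ord_le_def)
  have P'2: "coeffs_in J P'"
    using P(2) dJ by (auto simp: coeffs_in_def P'_def intro: difference_subringD(1-6)[OF J])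
  have diff: "P' ^ N - P ^ N = (\<Sum>k<N. P' ^ k * monom d (- int j) * P ^ (N - 1 - k))"
    using power_intertwine[of P' N 1 P] by (simp add: P'_def)
  note top = sandwich_top[OF P'1 P(1) ord_le_monom[of "- int j" d], of N, folded diff]
  have e: "- int j + int N - 1 = int N - 1 - int j" by simp
  have "ord_le (int N - 1 - int j) ((P' ^ N - P ^ N) + (P ^ N - L))"
    using ord_le_add[OF top(1)[unfolded e] P(3)] .
  moreover have "cf ((P' ^ N - P ^ N) + (P ^ N - L)) (int N - 1 - int j) = 0"
    using top(2)[unfolded e] d by simp
  ultimately have "ord_le (int N - 1 - int (Suc j)) (P' ^ N - L)"
    unfolding ord_le_def
  proof safe
    fix n assume a: "\<forall>n>int N - 1 - int j. cf (P' ^ N - P ^ N + (P ^ N - L)) n = 0"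
      "cf (P' ^ N - P ^ N + (P ^ N - L)) (int N - 1 - int j) = 0" "int N - 1 - int (Suc j) < n"
    have "n = int N - 1 - int j \<or> n > int N - 1 - int j" using a(3) by auto
    then show "cf (P' ^ N - L) n = 0" using a(1,2) by auto
  qed
  then show ?thesis using P'1 P'2 by (intro exI[of _ P']) (auto simp: P'_def ord_le_def)
qed

lemma root_exists:
  assumes J: "difference_subring N J" and N: "0 < N"
    and L: "monic (int N) L" "coeffs_in J L"
  obtains P where "monic 1 P" "coeffs_in J P" "P ^ N = L"
proof -
  let ?I = "\<lambda>j P. monic 1 P \<and> coeffs_in J P \<and> ord_le (int N - 1 - int j) (P ^ N - L)"
  \<comment> \<open>The approximation starts from \<open>monom 1 1\<close>, which is
    \<open>D\<close>: its N-th power agrees with \<open>L\<close> at order \<open>N\<close> and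
    above.\<close>
  have mD: "monic 1 (monom 1 1 :: 'a skew)" by (simp add: monic_def ord_le_monom)
  have "ord_le (int N - 1 - int 0) (monom 1 1 ^ N - L)"
    unfolding ord_le_def
  proof safe
    fix n assume "int N - 1 - int 0 < n"
    then have "n = int N \<or> n > int N" by auto
    then show "cf (monom 1 1 ^ N - L) n = 0"
      using monic_power[OF mD, of N] L(1) by (auto simp: monic_def ord_le_def)
  qed
  then have "\<exists>P. ?I 0 P"
    using mD by (intro exI[of _ "monom 1 1"]) (auto simp: coeffs_in_def intro: difference_subringD(1-6)[OF J])
  moreover have "\<And>P j. ?I j P \<Longrightarrow> \<exists>P'. ?I (Suc j) P' \<and> ord_le (- int j) (P' - P)"
    using root_step[OF J N L(2)] by blast
  ultimately have "\<exists>Q. \<forall>j. ?I j (Q j) \<and> ord_le (- int j) (Q (Suc j) - Q j)"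
    by (rule dependent_nat_choice)
  then obtain Q where Q: "\<And>j. ?I j (Q j)" "\<And>j. ord_le (- int j) (Q (Suc j) - Q j)" by blast
  have stable: "cf (Q j) n = cf (Q i) n" if "i \<le> j" "n > - int i" for i j n
    using that
  proof (induction j rule: dec_induct)
    case (step k)
    then have "cf (Q (Suc k) - Q k) n = 0" using ord_leD[OF Q(2)[of k]] by auto
    then show ?case using step by simp
  qed simp
  \<comment> \<open>The correction made at stage \<open>j\<close> has order at most
    \<open>- j\<close>, so the coefficient of \<open>D^n\<close> is final from stage
    \<open>1 - n\<close> on, or from stage 0 if \<open>n\<close> is positive.\<close>
  define p where "p = (\<lambda>n. cf (Q (nat (1 - n))) n)"
  have p0: "p n = 0" if "n > 1" for n
    using Q(1)[of "nat (1 - n)"] that by (auto simp: p_def monic_def ord_le_def)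
  define P where "P = Skew p"
  have cfP: "cf P = p" unfolding P_def using p0 by (intro Skew_inverse) auto
  have close: "ord_le (- int j) (P - Q j)" for j
    unfolding ord_le_def using stable[of "nat (1 - n)" j n for n] by (auto simp: cfP p_def)
  have P1: "monic 1 P"
    using p0 Q(1)[of 0] by (auto simp: monic_def ord_le_def cfP p_def)
  have P2: "coeffs_in J P" using Q(1) by (auto simp: coeffs_in_def cfP p_def)
  have "ord_le (int N - 1 - int j) (P ^ N - L)" for j
  proof -
    have "P ^ N - Q j ^ N = (\<Sum>k<N. P ^ k * (P - Q j) * Q j ^ (N - 1 - k))"
      using power_intertwine[of P N 1 "Q j"] by simp
    moreover have "- int j + int N - 1 = int N - 1 - int j" by simp
    ultimately have "ord_le (int N - 1 - int j) (P ^ N - Q j ^ N)"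
      using sandwich_top(1)[OF P1 _ close[of j], of "Q j" N] Q(1)[of j] by metis
    then have "ord_le (int N - 1 - int j) ((P ^ N - Q j ^ N) + (Q j ^ N - L))"
      using Q(1)[of j] by (blast intro: ord_le_add)
    then show ?thesis by simp
  qed
  note PL = this
  have "cf (P ^ N - L) n = 0" for n
  proof (rule ord_leD[OF PL])
    show "int N - 1 - int (nat (int N - n)) < n" by linarith
  qed
  then have "P ^ N = L" by (intro skew_eqI) (simp add: algebra_simps)
  then show ?thesis using that P1 P2 by blast
qed

text \<open>Coefficients of the geometric series
  \<open>(D - f)^(-1) = D^(-1) + D^(-1) f D^(-1) + ...\<close>; \<open>geom f j\<close> belongs to
  \<open>D^(-1-j)\<close>.\<close>

fun geom :: "'a::difference_ring \<Rightarrow> nat \<Rightarrow> 'a" where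
  "geom f 0 = 1"
| "geom f (Suc j) = sh (- 1) (f * geom f j)"

text \<open>The defining recursion peels a factor off on the left and gives the right inverse of
  \<open>D - f\<close>; this one peels it off on the right and gives the left inverse.\<close>

lemma geom_Suc: "geom f (Suc j) = geom f j * sh (- 1 - int j) f"
proof (induction j)
  case (Suc j)
  have "geom f (Suc (Suc j)) = sh (- 1) (f * (geom f j * sh (- 1 - int j) f))"
    using Suc by simp
  also have "\<dots> = geom f (Suc j) * sh (- 1 + (- 1 - int j)) f"
    by (simp only: sh_mult sh_sh mult.assoc geom.simps)
  also have "- 1 + (- 1 - int j) = - 1 - int (Suc j)" by simp
  finally show ?case .
qed simp

lemma linear_invertible:
  fixes f :: "'a::difference_ring"
  obtains b where "(monom 1 1 - monom f 0) * b = 1" "b * (monom 1 1 - monom f 0) = 1"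
proof -
  define y where "y = (\<lambda>n. if n \<le> - 1 then geom f (nat (- 1 - n)) else 0)"
  define b where "b = Skew y"
  have cfb: "cf b = y" unfolding b_def by (rule Skew_inverse) (auto simp: y_def intro: exI[of _ 0])
  have *: "n \<le> - 1 \<Longrightarrow> nat (- n) = Suc (nat (- 1 - n))" for n by auto
  have "(monom 1 1 - monom f 0) * b = 1"
  proof (rule skew_eqI)
    fix n
    show "cf ((monom 1 1 - monom f 0) * b) n = cf 1 n"
      by (auto simp: left_diff_distrib cf_monom_mult cfb y_def *)
  qed
  moreover have "b * (monom 1 1 - monom f 0) = 1"
  proof (rule skew_eqI)
    fix n
    show "cf (b * (monom 1 1 - monom f 0)) n = cf 1 n"
      by (auto simp: right_diff_distrib cf_mult_monom cfb y_def * geom_Suc simp del: geom.simps(2))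
  qed
  ultimately show ?thesis using that by blast
qed

section \<open>Variation of traces of roots\<close>

text \<open>Isolates the formal calculation: \<open>tr\<close> will be
  \<open>\<integral> Res\<close>, and \<open>\<delta>\<close> a variation acting on
  coefficients.\<close>

locale trace_derivation =
  fixes tr :: "'r::ring_1 \<Rightarrow> 'b::comm_ring_1" and \<delta> :: "'r \<Rightarrow> 'r"
  assumes tr_add: "tr (x + y) = tr x + tr y"
    and tr_commute: "tr (x * y) = tr (y * x)"
    and deriv_mult: "\<delta> (x * y) = \<delta> x * y + x * \<delta> y"
begin

lemma tr_0 [simp]: "tr 0 = 0"
  using tr_add[of 0 0] by simp

lemma deriv_1 [simp]: "\<delta> 1 = 0"
  using deriv_mult[of 1 1] by simp

text \<open>By cyclicity all Leibniz terms have the same trace. The induction needs arbitrary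
  \<open>z\<close>, since it passes from \<open>z\<close> to \<open>z * p\<close>.\<close>

lemma tr_deriv_power:
  assumes "z * p = p * z"
  shows "tr (z * \<delta> (p ^ Suc n)) = of_nat (Suc n) * tr (z * p ^ n * \<delta> p)"
  using assms
proof (induction n arbitrary: z)
  case (Suc n)
  have zp: "z * p * p = p * (z * p)" by (metis Suc.prems mult.assoc)
  have "z * p ^ Suc n = p ^ Suc n * z"
    using power_commuting_commutes[OF Suc.prems[symmetric], of "Suc n"] by simp
  then have "tr (z * (\<delta> p * p ^ Suc n)) = tr (z * p ^ Suc n * \<delta> p)"
    using tr_commute[of "z * \<delta> p" "p ^ Suc n"] by (simp add: mult.assoc)
  moreover have "tr (z * (p * \<delta> (p ^ Suc n))) = of_nat (Suc n) * tr (z * p ^ Suc n * \<delta> p)"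
    using Suc.IH[OF zp] by (simp add: mult.assoc)
  moreover have "\<delta> (p ^ Suc (Suc n)) = \<delta> p * p ^ Suc n + p * \<delta> (p ^ Suc n)"
    by (metis deriv_mult power_Suc)
  ultimately show ?case
    by (simp add: distrib_left tr_add del: power_Suc) (simp add: algebra_simps)
qed simp

text \<open>A logarithmic derivative under the trace. Here \<open>c\<close> is the inverse of the
  partial product; cyclicity together with \<open>pa\<close> moves the remaining factors around
  until each term keeps a single inverse \<open>b\<close>.\<close>

lemma tr_log_deriv_prod:
  assumes ab: "\<And>i. a i * b i = 1" and ba: "\<And>i. b i * a i = 1"
    and pa: "\<And>i. p i * a i = a i * p (Suc i)"
  shows "\<exists>c. c * (\<Prod>k\<leftarrow>[0..<l]. a (i + k)) = 1 \<and> (\<Prod>k\<leftarrow>[0..<l]. a (i + k)) * c = 1 \<and>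
    tr (p (i + l) * c * \<delta> (\<Prod>k\<leftarrow>[0..<l]. a (i + k))) = (\<Sum>j<l. tr (b (i + j) * p (i + j) * \<delta> (a (i + j))))"
proof (induction l)
  case 0
  show ?case by (intro exI[of _ 1]) simp
next
  case (Suc l)
  let ?A = "\<Prod>k\<leftarrow>[0..<l]. a (i + k)" and ?a = "a (i + l)" and ?b = "b (i + l)"
  let ?p = "p (i + l)" and ?p' = "p (Suc (i + l))"
  obtain c where c: "c * ?A = 1" "?A * c = 1"
    "tr (?p * c * \<delta> ?A) = (\<Sum>j<l. tr (b (i + j) * p (i + j) * \<delta> (a (i + j))))"
    using Suc by blast
  have 1: "?a * ?p' * ?b = ?p" by (metis ab pa mult.assoc mult_1_right)
  have 2: "?p' * ?b = ?b * ?p" by (metis ab ba pa mult.assoc mult_1_left mult_1_right)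
  have A: "(\<Prod>k\<leftarrow>[0..<Suc l]. a (i + k)) = ?A * ?a" by simp
  have "?b * c * (?A * ?a) = ?b * (c * ?A) * ?a" by (simp add: mult.assoc)
  also have "\<dots> = 1" using c(1) ba by simp
  finally have inv1: "?b * c * (?A * ?a) = 1" .
  have "?A * ?a * (?b * c) = ?A * (?a * ?b) * c" by (simp add: mult.assoc)
  also have "\<dots> = 1" using c(2) ab by simp
  finally have inv2: "?A * ?a * (?b * c) = 1" .
  have "?p' * (?b * c) * (\<delta> ?A * ?a + ?A * \<delta> ?a)
      = (?p' * (?b * c) * \<delta> ?A) * ?a + ?p' * ?b * (c * ?A) * \<delta> ?a"
    by (simp add: algebra_simps)
  then have "tr (?p' * (?b * c) * \<delta> (?A * ?a))
      = tr (?a * (?p' * (?b * c) * \<delta> ?A)) + tr (?p' * ?b * \<delta> ?a)"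
    using tr_commute[of "?p' * (?b * c) * \<delta> ?A" ?a] c(1) by (simp add: deriv_mult tr_add)
  also have "?a * (?p' * (?b * c) * \<delta> ?A) = ?a * ?p' * ?b * c * \<delta> ?A" by (simp add: mult.assoc)
  finally have "tr (?p' * (?b * c) * \<delta> (?A * ?a)) =
    (\<Sum>j<Suc l. tr (b (i + j) * p (i + j) * \<delta> (a (i + j))))"
    using c(3) 1 2 by simp
  then show ?case unfolding A using inv1 inv2 by (intro exI[of _ "?b * c"]) simp
qed

text \<open>With \<open>P = P i\<close>, the trace of \<open>P^(n+1) P^(-N) \<delta>(P^N)\<close> is
  evaluated twice: as the derivative of a power it is \<open>N\<close> times the trace of
  \<open>P^n \<delta>P\<close>, as the derivative of a product it is the sum over the
  factors.\<close>

lemma tr_root_variation: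
  assumes N: "0 < N" and root: "P i ^ N = (\<Prod>k\<leftarrow>[0..<N]. a (i + k))" and per: "P (i + N) = P i"
    and Pa: "\<And>i. P i * a i = a i * P (Suc i)"
    and ab: "\<And>i. a i * b i = 1" and ba: "\<And>i. b i * a i = 1"
  shows "of_nat N * tr (\<delta> (P i ^ Suc n)) =
    of_nat (Suc n) * (\<Sum>j<N. tr (b (i + j) * P (i + j) ^ Suc n * \<delta> (a (i + j))))"
proof -
  have Pna: "P i ^ m * a i = a i * P (Suc i) ^ m" for m i
    by (induction m) (simp_all add: mult.assoc, metis Pa mult.assoc)
  let ?P = "P i"
  obtain c where c: "c * ?P ^ N = 1" "?P ^ N * c = 1"
    and tr: "tr (?P ^ Suc n * c * \<delta> (?P ^ N)) =
      (\<Sum>j<N. tr (b (i + j) * P (i + j) ^ Suc n * \<delta> (a (i + j))))"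
    using tr_log_deriv_prod[of a b "\<lambda>i. P i ^ Suc n" i N, OF ab ba Pna] root per by auto
  have N': "N = Suc (N - 1)" using N by simp
  have "c * ?P = c * ?P * (?P ^ N * c)" by (simp add: c)
  also have "\<dots> = c * ?P ^ N * ?P * c" by (metis mult.assoc power_commutes)
  finally have cP: "c * ?P = ?P * c" by (simp add: c)
  have "?P ^ Suc n * c * ?P ^ (N - 1) = ?P ^ Suc n * (c * ?P ^ (N - 1))" by (simp add: mult.assoc)
  also have "c * ?P ^ (N - 1) = ?P ^ (N - 1) * c"
    using power_commuting_commutes[OF cP[symmetric], of "N - 1"] by simp
  also have "?P ^ Suc n * (?P ^ (N - 1) * c) = ?P ^ n * (?P ^ Suc (N - 1) * c)"
    by (simp only: power_Suc2[of ?P n] power_Suc[of ?P "N - 1"] mult.assoc)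
  also have "\<dots> = ?P ^ n" using c(2) N' by simp
  finally have eq: "?P ^ Suc n * c * ?P ^ (N - 1) = ?P ^ n" .
  have "?P ^ Suc n * c * ?P = ?P * (?P ^ Suc n * c)"
    by (simp only: mult.assoc cP) (simp only: power_commutes flip: mult.assoc)
  \<comment> \<open>The weight \<open>P^(n+1) P^(-N)\<close> commutes with \<open>P\<close>, so the
    rule for powers applies with exponent \<open>N\<close>.\<close>
  from tr_deriv_power[OF this, of "N - 1"] N' eq
  have E: "of_nat N * tr (?P ^ n * \<delta> ?P) =
      (\<Sum>j<N. tr (b (i + j) * P (i + j) ^ Suc n * \<delta> (a (i + j))))"
    using tr by simp
  have t: "tr (\<delta> (?P ^ Suc n)) = of_nat (Suc n) * tr (?P ^ n * \<delta> ?P)"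
    using tr_deriv_power[of 1 ?P n] by simp
  show ?thesis unfolding t mult.left_commute[of "of_nat N"] E ..
qed

end

section \<open>Coefficientwise derivations and the residue trace\<close>

definition skew_map :: "('a::zero \<Rightarrow> 'a) \<Rightarrow> 'a skew \<Rightarrow> 'a skew" where
  "skew_map f R = Skew (\<lambda>n. f (cf R n))"

lemma cf_skew_map: "f 0 = 0 \<Longrightarrow> cf (skew_map f R) n = f (cf R n)"
proof -
  assume "f 0 = 0"
  moreover obtain M where "\<forall>n>M. cf R n = 0" using cf[of R] by auto
  ultimately have "\<exists>M. \<forall>n>M. f (cf R n) = 0" by (intro exI[of _ M]) simp
  then show ?thesis by (simp add: skew_map_def Skew_inverse)
qed

text \<open>Cyclicity: the term for \<open>k\<close> in one product and for \<open>- k\<close> in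
  the other differ by a shift, which \<open>I\<close> does not see. Compatibility of
  \<open>d\<close> with shifts makes the coefficientwise map a derivation of the twisted
  product.\<close>

lemma residue_trace_derivation:
  fixes I :: "'a::difference_ring \<Rightarrow> 'b::comm_ring_1"
  assumes I: "\<And>x y. I (x + y) = I x + I y" "\<And>k x. I (sh k x) = I x"
    and d: "\<And>x y. d (x + y) = d x + d y" "\<And>x y. d (x * y) = d x * y + x * d y"
      "\<And>k x. d (sh k x) = sh k (d x)"
  shows "trace_derivation (\<lambda>R. I (cf R 0)) (skew_map d)"
proof
  have I0: "I 0 = 0" using I(1)[of 0 0] by simp
  have d0: "d 0 = 0" using d(1)[of 0 0] by simp
  have Isum: "I (sum f A) = (\<Sum>x\<in>A. I (f x))" for f :: "int \<Rightarrow> 'a" and A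
    by (induction A rule: infinite_finite_induct) (auto simp: I I0)
  have dsum: "d (sum f A) = (\<Sum>x\<in>A. d (f x))" for f :: "int \<Rightarrow> 'a" and A
    by (induction A rule: infinite_finite_induct) (auto simp: d d0)
  fix R S :: "'a skew"
  obtain a where R: "ord_le a R" by (rule ord_leE)
  obtain b where S: "ord_le b S" by (rule ord_leE)
  have dR: "ord_le a (skew_map d R)" and dS: "ord_le b (skew_map d S)"
    using R S by (auto simp: ord_le_def cf_skew_map d0)
  show "I (cf (R + S) 0) = I (cf R 0) + I (cf S 0)" by (simp add: I)
  have "I (cf (R * S) 0) = (\<Sum>k\<in>{-b..a}. I (cf R k * sh k (cf S (- k))))"
    by (subst cf_mult[OF R S, of "-b" _ a]) (auto simp: Isum)
  also have "\<dots> = (\<Sum>k\<in>{-a..b}. I (cf S k * sh k (cf R (- k))))"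
  proof (rule sum.reindex_bij_witness[of _ uminus uminus])
    fix k
    have "I (cf S (- k) * sh (- k) (cf R k)) = I (sh k (cf S (- k) * sh (- k) (cf R k)))"
      by (simp add: I)
    then show "I (cf S (- k) * sh (- k) (cf R (- (- k)))) = I (cf R k * sh k (cf S (- k)))"
      by (simp add: sh_mult mult.commute)
  qed auto
  also have "\<dots> = I (cf (S * R) 0)"
    by (subst cf_mult[OF S R, of "-a" _ b]) (auto simp: Isum)
  finally show "I (cf (R * S) 0) = I (cf (S * R) 0)" .
  show "skew_map d (R * S) = skew_map d R * S + R * skew_map d S"
  proof (rule skew_eqI)
    fix n
    show "cf (skew_map d (R * S)) n = cf (skew_map d R * S + R * skew_map d S) n"
      by (simp add: cf_skew_map d0 cf_mult[OF R S order_refl order_refl]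
          cf_mult[OF dR S order_refl order_refl] cf_mult[OF R dS order_refl order_refl]
          dsum d sum.distrib)
  qed
qed

section \<open>Shifts and derivations of series\<close>

lemma coeff_Const_mult: "coeff (Const c * f) \<mu> = c * coeff f \<mu>"
proof -
  have "coeff (Const c * f) \<mu> = (\<Sum>(\<alpha>, \<beta>) \<in> {({#} :: var multiset, \<mu>)}. (if \<alpha> = {#} then c else 0) * coeff f \<beta>)"
    unfolding times_lser.rep_eq Const.rep_eq by (rule sum.mono_neutral_right) (auto split: if_splits)
  then show ?thesis by simp
qed

lemma coeff_Var_mult: "coeff (Var x * f) \<mu> = (if x \<in># \<mu> then coeff f (\<mu> - {#x#}) else 0)"
proof -
  have "coeff (Var x * f) \<mu> =
    (\<Sum>(\<alpha>, \<beta>) \<in> (if x \<in># \<mu> then {({#x#}, \<mu> - {#x#})} else {}). (if \<alpha> = {#x#} then 1 else 0) * coeff f \<beta>)"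
    unfolding times_lser.rep_eq Var.rep_eq by (rule sum.mono_neutral_right) (auto split: if_splits)
  then show ?thesis by simp
qed

lemma coeff_sum: "coeff (sum f A) \<mu> = (\<Sum>x\<in>A. coeff (f x) \<mu>)"
  by (induction A rule: infinite_finite_induct) (auto simp: zero_lser.rep_eq plus_lser.rep_eq)

lemma shift_0 [simp]: "shift q 0 f = f"
  by transfer simp

lemma shift_shift: "q \<noteq> 0 \<Longrightarrow> shift q k (shift q l f) = shift q (k + l) f"
proof (rule lser_eqI)
  fix \<mu> assume q: "q \<noteq> 0"
  have "- (k + l) * weight \<mu> = - k * weight \<mu> + - l * weight \<mu>" by (simp add: algebra_simps)
  then have "q powi (- (k + l) * weight \<mu>) = q powi (- k * weight \<mu>) * q powi (- l * weight \<mu>)"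
    by (simp only: power_int_add[OF disjI1[OF q]])
  then show "coeff (shift q k (shift q l f)) \<mu> = coeff (shift q (k + l) f) \<mu>"
    by (simp add: shift.rep_eq)
qed

lemma shift_add: "shift q k (f + g) = shift q k f + shift q k g"
  by transfer (auto simp: algebra_simps)

lemma shift_mult: "q \<noteq> 0 \<Longrightarrow> shift q k (f * g) = shift q k f * shift q k g"
proof (rule lser_eqI)
  fix \<mu> assume q: "q \<noteq> 0"
  have "q powi (- k * weight \<mu>) * (\<Sum>(\<alpha>, \<beta>) | \<alpha> + \<beta> = \<mu>. coeff f \<alpha> * coeff g \<beta>) =
    (\<Sum>(\<alpha>, \<beta>) | \<alpha> + \<beta> = \<mu>. q powi (- k * weight \<alpha>) * coeff f \<alpha> * (q powi (- k * weight \<beta>) * coeff g \<beta>))"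
    unfolding sum_distrib_left
  proof (rule sum.cong[OF refl])
    fix p assume "p \<in> {(\<alpha>, \<beta>). \<alpha> + \<beta> = \<mu>}"
    then obtain \<alpha> \<beta> where p: "p = (\<alpha>, \<beta>)" "\<mu> = \<alpha> + \<beta>" by auto
    have "- k * weight \<mu> = - k * weight \<alpha> + - k * weight \<beta>"
      by (simp add: p weight_add distrib_left)
    then have "q powi (- k * weight \<mu>) = q powi (- k * weight \<alpha>) * q powi (- k * weight \<beta>)"
      by (simp only: power_int_add[OF disjI1[OF q]])
    then show "q powi (- k * weight \<mu>) * (case p of (\<alpha>, \<beta>) \<Rightarrow> coeff f \<alpha> * coeff g \<beta>) =
      (case p of (\<alpha>, \<beta>) \<Rightarrow> q powi (- k * weight \<alpha>) * coeff f \<alpha> * (q powi (- k * weight \<beta>) * coeff g \<beta>))"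
      by (simp add: p)
  qed
  then show "coeff (shift q k (f * g)) \<mu> = coeff (shift q k f * shift q k g) \<mu>"
    by (simp add: times_lser.rep_eq shift.rep_eq)
qed

lemma shift_1 [simp]: "shift q k 1 = 1"
  by transfer (auto simp: weight_def fun_eq_iff)

lemma generic_powi_neq_1:
  fixes q :: complex
  assumes q: "q \<noteq> 0" "\<And>k::nat. k \<ge> 1 \<Longrightarrow> q ^ k \<noteq> 1" and m: "m \<noteq> 0"
  shows "q powi m \<noteq> 1"
proof (cases "m > 0")
  case True
  then show ?thesis using q(2)[of "nat m"] by (auto simp: power_int_def)
next
  case False
  then show ?thesis using q(2)[of "nat (- m)"] m by (auto simp: power_int_def power_inverse)
qed

text \<open>On the part of weight \<open>w\<close>, \<open>1 + D + ... + D^(n-1)\<close> is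
  multiplication by this number, which is \<open>n\<close> when \<open>w = 0\<close>.\<close>

lemma generic_geometric_sum:
  fixes q :: complex
  assumes q: "q \<noteq> 0" "\<And>k::nat. k \<ge> 1 \<Longrightarrow> q ^ k \<noteq> 1" and n: "0 < n"
  shows "(\<Sum>l<n. q powi (- int l * w)) \<noteq> 0"
proof (cases "w = 0")
  case False
  let ?r = "q powi (- w)"
  have "?r \<noteq> 1" using generic_powi_neq_1[OF q] False by auto
  moreover have "?r ^ n = q powi (- w * int n)" by (simp only: power_int_mult power_int_of_nat)
  then have "?r ^ n \<noteq> 1" using generic_powi_neq_1[OF q, of "- w * int n"] False n by auto
  ultimately have "(\<Sum>l<n. ?r ^ l) \<noteq> 0" by (simp add: geometric_sum)
  moreover have "q powi (- int l * w) = ?r ^ l" for l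
  proof -
    have "- int l * w = - w * int l" by simp
    then show ?thesis by (simp only: power_int_mult power_int_of_nat)
  qed
  ultimately show ?thesis by simp
qed (use n in auto)

text \<open>
  The product of operators depends on \<open>q\<close>, so it cannot be the multiplication of a type. Families
  indexed by all generic \<open>q\<close> at once, with pointwise operations, make it one.
\<close>

typedef generic = "{q :: complex. q \<noteq> 0 \<and> (\<forall>k::nat. k \<ge> 1 \<longrightarrow> q ^ k \<noteq> 1)}"
proof
  have "(2 :: complex) ^ k \<noteq> 1" if "k \<ge> 1" for k :: nat
  proof
    assume "(2 :: complex) ^ k = 1"
    then have "norm ((2 :: complex) ^ k) = 1" by simp
    then show False using that one_less_power[of "2 :: real" k] by (simp add: norm_power)
  qed
  then show "2 \<in> {q :: complex. q \<noteq> 0 \<and> (\<forall>k::nat. k \<ge> 1 \<longrightarrow> q ^ k \<noteq> 1)}" by auto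
qed

lemma generic: "Rep_generic q \<noteq> 0" "k \<ge> 1 \<Longrightarrow> Rep_generic q ^ k \<noteq> 1"
  using Rep_generic[of q] by auto

typedef lfam = "UNIV :: (generic \<Rightarrow> lser) set"
  morphisms at_q Lfam by simp

setup_lifting type_definition_lfam

lemma lfam_eqI: "(\<And>q. at_q f q = at_q g q) \<Longrightarrow> f = g"
  by transfer auto

instantiation lfam :: comm_ring_1
begin

lift_definition zero_lfam :: lfam is "\<lambda>_. 0" .
lift_definition one_lfam :: lfam is "\<lambda>_. 1" .
lift_definition plus_lfam :: "lfam \<Rightarrow> lfam \<Rightarrow> lfam" is "\<lambda>f g q. f q + g q" .
lift_definition uminus_lfam :: "lfam \<Rightarrow> lfam" is "\<lambda>f q. - f q" .
lift_definition minus_lfam :: "lfam \<Rightarrow> lfam \<Rightarrow> lfam" is "\<lambda>f g q. f q - g q" .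
lift_definition times_lfam :: "lfam \<Rightarrow> lfam \<Rightarrow> lfam" is "\<lambda>f g q. f q * g q" .

instance
proof
  fix a b c :: lfam
  note simps = zero_lfam.rep_eq one_lfam.rep_eq plus_lfam.rep_eq uminus_lfam.rep_eq
    minus_lfam.rep_eq times_lfam.rep_eq
  show "a * b * c = a * (b * c)" "a * b = b * a" "1 * a = a" "a + b + c = a + (b + c)"
    "a + b = b + a" "0 + a = a" "- a + a = 0" "a - b = a + - b" "(a + b) * c = a * c + b * c"
    by (rule lfam_eqI; simp add: simps algebra_simps)+
  have "at_q 0 q \<noteq> at_q 1 q" for q by (simp add: simps)
  then show "(0 :: lfam) \<noteq> 1" by metis
qed

end

lemmas at_q_simps [simp] = zero_lfam.rep_eq one_lfam.rep_eq plus_lfam.rep_eq uminus_lfam.rep_eq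
  minus_lfam.rep_eq times_lfam.rep_eq

lemma at_q_sum: "at_q (sum f A) q = (\<Sum>x\<in>A. at_q (f x) q)"
  by (induction A rule: infinite_finite_induct) auto

lemma shift_solve:
  assumes q: "q \<noteq> 0" "\<And>k::nat. k \<ge> 1 \<Longrightarrow> q ^ k \<noteq> 1" and n: "0 < n"
  shows "\<exists>f. (\<Sum>l<n. shift q (int l) f) = r"
    and "(\<Sum>l<n. shift q (int l) f) = 0 \<Longrightarrow> f = 0"
proof -
  have sum: "coeff (\<Sum>l<n. shift q (int l) f) \<mu> = (\<Sum>l<n. q powi (- int l * weight \<mu>)) * coeff f \<mu>" for f \<mu>
    by (simp add: coeff_sum shift.rep_eq sum_distrib_right)
  \<comment> \<open>The operator is diagonal on monomials, so it is inverted by division.\<close>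
  let ?f = "Lser (\<lambda>\<mu>. coeff r \<mu> / (\<Sum>l<n. q powi (- int l * weight \<mu>)))"
  have "(\<Sum>l<n. shift q (int l) ?f) = r"
    using generic_geometric_sum[OF q n] by (intro lser_eqI) (simp add: sum Lser_inverse)
  then show "\<exists>f. (\<Sum>l<n. shift q (int l) f) = r" by blast
  assume 0: "(\<Sum>l<n. shift q (int l) f) = 0"
  have "coeff f \<mu> = 0" for \<mu>
    using sum[of f \<mu>] generic_geometric_sum[OF q n, of "weight \<mu>"] by (simp add: 0 zero_lser.rep_eq)
  then show "f = 0" by (intro lser_eqI) (simp add: zero_lser.rep_eq)
qed

instantiation lfam :: difference_ring
begin

lift_definition sh_lfam :: "int \<Rightarrow> lfam \<Rightarrow> lfam" is "\<lambda>k f q. shift (Rep_generic q) k (f q)" .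

instance
proof
  fix x y :: lfam and k l :: int and n :: nat
  show "sh 0 x = x" "sh k (sh l x) = sh (k + l) x" "sh k (x + y) = sh k x + sh k y"
    "sh k (x * y) = sh k x * sh k y" "sh k 1 = (1 :: lfam)"
    by (rule lfam_eqI; simp add: sh_lfam.rep_eq generic shift_shift shift_add shift_mult)+
  have sum: "at_q (\<Sum>l<n. sh (int l) x) q = (\<Sum>l<n. shift (Rep_generic q) (int l) (at_q x q))" for x q
    by (simp add: at_q_sum sh_lfam.rep_eq)
  assume n: "0 < n"
  have "\<exists>f. \<forall>q. (\<Sum>l<n. shift (Rep_generic q) (int l) (f q)) = at_q y q"
    using shift_solve(1)[OF generic n] by (intro choice) blast
  then obtain f where "\<And>q. (\<Sum>l<n. shift (Rep_generic q) (int l) (f q)) = at_q y q" by blast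
  then have "(\<Sum>l<n. sh (int l) (Lfam f)) = y"
    by (intro lfam_eqI) (simp add: sum Lfam_inverse)
  then show "\<exists>x. (\<Sum>l<n. sh (int l) x) = y" by blast
  assume "(\<Sum>l<n. sh (int l) x) = 0"
  then have "at_q x q = 0" for q
    using shift_solve(2)[OF generic n, of q "at_q x q"] by (simp flip: sum)
  then show "x = 0" by (intro lfam_eqI) simp
qed

end

lemma at_q_sh: "at_q (sh k f) q = shift (Rep_generic q) k (at_q f q)"
  by (simp add: sh_lfam.rep_eq)

text \<open>
  Varying the variable \<open>x\<close> alone is not compatible with the shift. The Euler derivation
  \<open>x \<partial>/\<partial>x\<close> is, and it determines \<open>\<partial>/\<partial>x\<close>.
\<close>

lift_definition euler :: "var \<Rightarrow> lser \<Rightarrow> lser" is "\<lambda>x f \<mu>. of_nat (count \<mu> x) * f \<mu>" .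

lemma pderiv_eqI:
  assumes "euler x f = Var x * g"
  shows "pderiv x f = g"
proof (rule lser_eqI)
  fix \<mu>
  have "coeff (pderiv x f) \<mu> = coeff (euler x f) (add_mset x \<mu>)"
    by (simp add: pderiv.rep_eq euler.rep_eq)
  then show "coeff (pderiv x f) \<mu> = coeff g \<mu>" by (simp add: assms coeff_Var_mult)
qed

lemma euler_add: "euler x (f + g) = euler x f + euler x g"
  by transfer (simp add: fun_eq_iff algebra_simps)

lemma euler_mult: "euler x (f * g) = euler x f * g + f * euler x g"
proof (rule lser_eqI)
  fix \<mu>
  show "coeff (euler x (f * g)) \<mu> = coeff (euler x f * g + f * euler x g) \<mu>"
    unfolding euler.rep_eq times_lser.rep_eq plus_lser.rep_eq sum_distrib_left sum.distrib[symmetric]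
    by (rule sum.cong) (auto simp: algebra_simps)
qed

lemma euler_shift: "euler x (shift q k f) = shift q k (euler x f)"
  by transfer (simp add: fun_eq_iff)

lemma euler_mode: "euler x (mode m f) = mode m (euler x f)"
  by transfer (simp add: fun_eq_iff)

lemma euler_Const_mult: "euler x (Const c * f) = Const c * euler x f"
  by (rule lser_eqI) (simp add: euler.rep_eq coeff_Const_mult)

lemma euler_sum: "euler x (sum f A) = (\<Sum>y\<in>A. euler x (f y))"
  by (rule lser_eqI) (simp add: euler.rep_eq coeff_sum sum_distrib_left)

lemma euler_Lam: "euler (k, b) (Lam i) = (if i = k then Var (k, b) else 0)"
proof (rule lser_eqI)
  fix \<mu>
  \<comment> \<open>Passing to the mode given by the weight of \<open>\<mu>\<close> replaces the
    infinite sum \<open>Lam i\<close> by a single variable.\<close>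
  have "coeff (Lam i) \<mu> = coeff (mode (weight \<mu>) (Lam i)) \<mu>" by (simp add: mode.rep_eq)
  then have L: "coeff (Lam i) \<mu> = (if \<mu> = {#(i, weight \<mu>)#} then 1 else 0)"
    by (simp add: mode_Lam Var.rep_eq)
  show "coeff (euler (k, b) (Lam i)) \<mu> = coeff (if i = k then Var (k, b) else 0) \<mu>"
  proof (cases "\<exists>w. \<mu> = {#(i, w)#}")
    case True
    then show ?thesis using L
      by (auto simp: euler.rep_eq Var.rep_eq zero_lser.rep_eq weight_def split: if_splits)
  next
    case False
    then show ?thesis using L by (auto simp: euler.rep_eq Var.rep_eq zero_lser.rep_eq)
  qed
qed

lemma mode_add: "mode m (f + g) = mode m f + mode m g"
  by transfer (simp add: fun_eq_iff)

lemma mode_minus: "mode m (- f) = - mode m f"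
  by transfer (simp add: fun_eq_iff)

lemma mode_diff: "mode m (f - g) = mode m f - mode m g"
  by transfer (simp add: fun_eq_iff)

lemma mode_sum: "mode m (sum f A) = (\<Sum>x\<in>A. mode m (f x))"
  by (rule lser_eqI) (simp add: mode.rep_eq coeff_sum)

lemma mode_mode [simp]: "mode m (mode m f) = mode m f"
  by transfer (simp add: fun_eq_iff)

lemma mode_Const_mult: "mode m (Const c * f) = Const c * mode m f"
  by (rule lser_eqI) (simp add: mode.rep_eq coeff_Const_mult)

lemma mode_0_shift: "mode 0 (shift q k f) = mode 0 f"
  by transfer (simp add: fun_eq_iff)

lemma mode_Var_mult: "mode m (Var x * f) = Var x * mode (m - snd x) f"
proof (rule lser_eqI)
  fix \<mu>
  show "coeff (mode m (Var x * f)) \<mu> = coeff (Var x * mode (m - snd x) f) \<mu>"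
  proof (cases "x \<in># \<mu>")
    case True
    then obtain \<nu> where "\<mu> = add_mset x \<nu>" by (metis mset_add)
    then show ?thesis by (auto simp: mode.rep_eq coeff_Var_mult weight_def)
  qed (simp add: mode.rep_eq coeff_Var_mult)
qed

section \<open>Locally finite sums and the bracket\<close>

text \<open>\<open>Sum_any\<close> takes the value 0 on infinite support; this condition excludes
  that default at every monomial.\<close>

definition lfin :: "('a \<Rightarrow> lser) \<Rightarrow> bool" where
  "lfin f \<longleftrightarrow> (\<forall>\<mu>. finite {x. coeff (f x) \<mu> \<noteq> 0})"

lemma lfinD: "lfin f \<Longrightarrow> finite {x. coeff (f x) \<mu> \<noteq> 0}"
  by (simp add: lfin_def)

lemma coeff_lfsum: "coeff (lfsum f) \<mu> = Sum_any (\<lambda>x. coeff (f x) \<mu>)"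
  by (simp add: lfsum.rep_eq)

lemma lfsum_pair:
  assumes "lfin f"
  shows "lfsum f = lfsum (\<lambda>x. lfsum (\<lambda>y. f (x, y)))" "lfsum f = lfsum (\<lambda>y. lfsum (\<lambda>x. f (x, y)))"
proof -
  have C: "finite (fst ` {p. coeff (f p) \<mu> \<noteq> 0} \<times> snd ` {p. coeff (f p) \<mu> \<noteq> 0})" for \<mu>
    using lfinD[OF assms] by simp
  have "coeff (lfsum f) \<mu> = Sum_any (\<lambda>(x, y). coeff (f (x, y)) \<mu>)" for \<mu>
    unfolding coeff_lfsum by (rule Sum_any.cong) auto
  moreover have "Sum_any (\<lambda>(x, y). coeff (f (x, y)) \<mu>) = Sum_any (\<lambda>x. Sum_any (\<lambda>y. coeff (f (x, y)) \<mu>))" for \<mu>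
    by (rule Sum_any.cartesian_product[OF C, symmetric]) (force simp: image_iff)
  ultimately show 1: "lfsum f = lfsum (\<lambda>x. lfsum (\<lambda>y. f (x, y)))"
    by (intro lser_eqI) (simp only: coeff_lfsum)
  have "Sum_any (\<lambda>x. Sum_any (\<lambda>y. coeff (f (x, y)) \<mu>)) = Sum_any (\<lambda>y. Sum_any (\<lambda>x. coeff (f (x, y)) \<mu>))" for \<mu>
    by (rule Sum_any.swap[OF C]) (force simp: image_iff)
  then show "lfsum f = lfsum (\<lambda>y. lfsum (\<lambda>x. f (x, y)))"
    unfolding 1 by (intro lser_eqI) (simp only: coeff_lfsum)
qed

lemma lfin_lfsum:
  assumes "lfin f"
  shows "lfin (\<lambda>x. lfsum (\<lambda>y. f (x, y)))"
  unfolding lfin_def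
proof
  fix \<mu>
  have "{x. coeff (lfsum (\<lambda>y. f (x, y))) \<mu> \<noteq> 0} \<subseteq> fst ` {p. coeff (f p) \<mu> \<noteq> 0}"
    unfolding coeff_lfsum by (force elim!: Sum_any.not_neutral_obtains_not_neutral)
  then show "finite {x. coeff (lfsum (\<lambda>y. f (x, y))) \<mu> \<noteq> 0}"
    by (rule finite_subset) (intro finite_imageI lfinD[OF assms])
qed

lemma lfin_slice:
  assumes "lfin f"
  shows "lfin (\<lambda>y. f (x, y))"
  unfolding lfin_def
proof
  fix \<mu>
  have "{y. coeff (f (x, y)) \<mu> \<noteq> 0} \<subseteq> snd ` {p. coeff (f p) \<mu> \<noteq> 0}" by force
  then show "finite {y. coeff (f (x, y)) \<mu> \<noteq> 0}"
    by (rule finite_subset) (intro finite_imageI lfinD[OF assms])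
qed

lemma lfsum_0 [simp]: "lfsum (\<lambda>_. 0) = 0"
  by (rule lser_eqI) (simp add: coeff_lfsum zero_lser.rep_eq)

lemma lfsum_mult:
  assumes "lfin f"
  shows "g * lfsum f = lfsum (\<lambda>x. g * f x)"
proof (rule lser_eqI)
  fix \<mu>
  let ?A = "{(\<alpha>, \<beta>). \<alpha> + \<beta> = \<mu>} :: (var multiset \<times> var multiset) set"
  let ?X = "\<Union>(\<alpha>, \<beta>)\<in>?A. {x. coeff (f x) \<beta> \<noteq> 0}"
  have X: "finite ?X" by (auto intro: lfinD[OF assms])
  have "coeff (g * lfsum f) \<mu> = (\<Sum>(\<alpha>, \<beta>)\<in>?A. coeff g \<alpha> * (\<Sum>x\<in>?X. coeff (f x) \<beta>))"
    unfolding times_lser.rep_eq coeff_lfsum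
  proof (rule sum.cong[OF refl])
    fix p assume p: "p \<in> ?A"
    obtain \<alpha> \<beta> where ab: "p = (\<alpha>, \<beta>)" by fastforce
    have "Sum_any (\<lambda>x. coeff (f x) \<beta>) = (\<Sum>x\<in>?X. coeff (f x) \<beta>)"
      by (rule Sum_any.expand_superset[OF X]) (use p ab in auto)
    then show "(case p of (\<alpha>, \<beta>) \<Rightarrow> coeff g \<alpha> * Sum_any (\<lambda>x. coeff (f x) \<beta>)) =
      (case p of (\<alpha>, \<beta>) \<Rightarrow> coeff g \<alpha> * (\<Sum>x\<in>?X. coeff (f x) \<beta>))" by (simp add: ab)
  qed
  also have "\<dots> = (\<Sum>p\<in>?A. \<Sum>x\<in>?X. coeff g (fst p) * coeff (f x) (snd p))"
    by (simp add: sum_distrib_left case_prod_unfold)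
  also have "\<dots> = (\<Sum>x\<in>?X. \<Sum>p\<in>?A. coeff g (fst p) * coeff (f x) (snd p))"
    by (rule sum.swap)
  also have "\<dots> = (\<Sum>x\<in>?X. coeff (g * f x) \<mu>)"
    by (simp add: times_lser.rep_eq case_prod_unfold)
  also have "\<dots> = coeff (lfsum (\<lambda>x. g * f x)) \<mu>"
    unfolding coeff_lfsum
    by (rule Sum_any.expand_superset[OF X, symmetric]) (auto elim!: coeff_mult_nonzeroE)
  finally show "coeff (g * lfsum f) \<mu> = coeff (lfsum (\<lambda>x. g * f x)) \<mu>" .
qed

lemma lfsum_minus: "lfsum (\<lambda>x. - f x) = - lfsum f"
proof (rule lser_eqI)
  fix \<mu>
  show "coeff (lfsum (\<lambda>x. - f x)) \<mu> = coeff (- lfsum f) \<mu>"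
    by (simp add: coeff_lfsum uminus_lser.rep_eq Sum_any.expand_set sum_negf)
qed

lemma lfsum_sum:
  assumes "finite A" "\<And>j. j \<in> A \<Longrightarrow> lfin (f j)"
  shows "(\<Sum>j\<in>A. lfsum (f j)) = lfsum (\<lambda>x. \<Sum>j\<in>A. f j x)"
proof (rule lser_eqI)
  fix \<mu>
  let ?X = "\<Union>j\<in>A. {x. coeff (f j x) \<mu> \<noteq> 0}"
  have X: "finite ?X" using assms by (auto intro: lfinD)
  have "coeff (\<Sum>j\<in>A. lfsum (f j)) \<mu> = (\<Sum>j\<in>A. \<Sum>x\<in>?X. coeff (f j x) \<mu>)"
    unfolding coeff_sum coeff_lfsum
    by (intro sum.cong Sum_any.expand_superset[OF X]) auto
  also have "\<dots> = (\<Sum>x\<in>?X. coeff (\<Sum>j\<in>A. f j x) \<mu>)"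
    unfolding coeff_sum by (rule sum.swap)
  also have "\<dots> = coeff (lfsum (\<lambda>x. \<Sum>j\<in>A. f j x)) \<mu>"
    unfolding coeff_lfsum coeff_sum
  proof (rule Sum_any.expand_superset[OF X, symmetric], clarify)
    fix x assume "(\<Sum>j\<in>A. coeff (f j x) \<mu>) \<noteq> 0"
    then obtain j where "j \<in> A" "coeff (f j x) \<mu> \<noteq> 0"
      by (rule sum.not_neutral_contains_not_neutral)
    then show "x \<in> ?X" by auto
  qed
  finally show "coeff (\<Sum>j\<in>A. lfsum (f j)) \<mu> = coeff (lfsum (\<lambda>x. \<Sum>j\<in>A. f j x)) \<mu>" .
qed

lemma lfsum_uminus_index: "lfsum (\<lambda>m::int. f (- m)) = lfsum f"
proof (rule lser_eqI)
  fix \<mu>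
  show "coeff (lfsum (\<lambda>m. f (- m))) \<mu> = coeff (lfsum f) \<mu>"
    unfolding coeff_lfsum
    by (rule Sum_any.reindex_cong[of uminus, symmetric]) (auto simp: o_def bij_uminus)
qed

lemma lfsum_eq_sum:
  assumes "finite A" "\<And>x. x \<notin> A \<Longrightarrow> f x = 0"
  shows "lfsum f = sum f A"
proof (rule lser_eqI)
  fix \<mu>
  have "coeff (f x) \<mu> = 0" if "x \<notin> A" for x using assms(2)[OF that] by (simp add: zero_lser.rep_eq)
  then show "coeff (lfsum f) \<mu> = coeff (sum f A) \<mu>"
    unfolding coeff_lfsum coeff_sum by (intro Sum_any.expand_superset[OF assms(1)]) blast
qed

lemma mode_mult': "mode m (R * S) = lfsum (\<lambda>k. mode (- k) R * mode (m + k) S)"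
  using lfsum_uminus_index[of "\<lambda>k. mode k R * mode (m - k) S"] by (simp add: mode_mult)

text \<open>The weight of the first part of a splitting fixes \<open>k\<close>, and a monomial has
  finitely many splittings.\<close>

lemma lfin_mode_mult: "lfin (\<lambda>k. mode (- k) R * f k)"
  unfolding lfin_def
proof
  fix \<mu>
  have "{k. coeff (mode (- k) R * f k) \<mu> \<noteq> 0} \<subseteq> (\<lambda>(\<alpha>, \<beta>). - weight \<alpha>) ` {(\<alpha>, \<beta>). \<alpha> + \<beta> = \<mu>}"
    by (force elim!: coeff_mult_nonzeroE simp: mode.rep_eq split: if_splits)
  then show "finite {k. coeff (mode (- k) R * f k) \<mu> \<noteq> 0}"
    by (rule finite_subset) simp
qed

text \<open>The variable \<open>(i, a - m)\<close> must occur in the monomial, which leaves finitely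
  many \<open>m\<close>.\<close>

lemma lfin_Var_mult: "lfin (\<lambda>m. Var (i, a - m) * f m)"
  unfolding lfin_def
proof
  fix \<mu>
  have "{m. coeff (Var (i, a - m) * f m) \<mu> \<noteq> 0} \<subseteq> (\<lambda>x. a - snd x) ` set_mset \<mu>"
    by (force simp: coeff_Var_mult split: if_splits)
  then show "finite {m. coeff (Var (i, a - m) * f m) \<mu> \<noteq> 0}"
    by (rule finite_subset) simp
qed

lemma lfin_mode_Var_mult: "lfin (\<lambda>(k, m). mode (- k) R * (Var (i, a - m) * f k m))"
  unfolding lfin_def
proof
  fix \<mu>
  have "{p. coeff (case p of (k, m) \<Rightarrow> mode (- k) R * (Var (i, a - m) * f k m)) \<mu> \<noteq> 0} \<subseteq>
      (\<Union>(\<alpha>, \<beta>)\<in>{(\<alpha>, \<beta>). \<alpha> + \<beta> = \<mu>}. {- weight \<alpha>} \<times> (\<lambda>x. a - snd x) ` set_mset \<beta>)"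
  proof clarify
    fix k m assume "coeff (mode (- k) R * (Var (i, a - m) * f k m)) \<mu> \<noteq> 0"
    then obtain \<alpha> \<beta> where ab: "\<alpha> + \<beta> = \<mu>" "coeff (mode (- k) R) \<alpha> \<noteq> 0"
      "coeff (Var (i, a - m) * f k m) \<beta> \<noteq> 0"
      by (rule coeff_mult_nonzeroE)
    have "k = - weight \<alpha>" using ab(2) by (simp add: mode.rep_eq split: if_splits)
    moreover have "(i, a - m) \<in># \<beta>" using ab(3) by (simp add: coeff_Var_mult split: if_splits)
    then have "m \<in> (\<lambda>x. a - snd x) ` set_mset \<beta>" by force
    ultimately show "(k, m) \<in> (\<Union>(\<alpha>, \<beta>)\<in>{(\<alpha>, \<beta>). \<alpha> + \<beta> = \<mu>}. {- weight \<alpha>} \<times> (\<lambda>x. a - snd x) ` set_mset \<beta>)"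
      using ab(1) by blast
  qed
  then show "finite {p. coeff (case p of (k, m) \<Rightarrow> mode (- k) R * (Var (i, a - m) * f k m)) \<mu> \<noteq> 0}"
    by (rule finite_subset) auto
qed

lemma pderiv_Var: "pderiv u (Var x) = (if u = x then 1 else 0)"
  by (rule lser_eqI) (auto simp: pderiv.rep_eq Var.rep_eq one_lser.rep_eq zero_lser.rep_eq)

lemma mode_Var: "mode (snd x) (Var x) = Var x"
  by (rule lser_eqI) (auto simp: mode.rep_eq Var.rep_eq weight_def)

section \<open>Expansion of the bracket in its arguments\<close>

lemma lfin_bracket:
  assumes "mode w F = F" "mode v G = G"
  shows "lfin (\<lambda>(x, y). pderiv x F * pderiv y G * var_bracket q N x y)"
proof -
  have "{p. coeff (case p of (x, y) \<Rightarrow> pderiv x F * pderiv y G * var_bracket q N x y) \<nu> \<noteq> 0} =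
    {(x, y). coeff (pderiv x F * pderiv y G * var_bracket q N x y) \<nu> \<noteq> 0}" for \<nu> by auto
  then show ?thesis using bracket_locally_finite[OF assms] by (simp add: lfin_def)
qed

lemma lfin_bracket_Var:
  assumes "mode v G = G"
  shows "lfin (\<lambda>y. pderiv y G * var_bracket q N x y)"
  using lfin_slice[OF lfin_bracket[OF mode_Var[of x] assms, of q N], of x]
  by (simp add: pderiv_Var)

lemma bracket_Var_left:
  assumes "mode v G = G"
  shows "bracket q N (Var x) G = lfsum (\<lambda>y. pderiv y G * var_bracket q N x y)"
proof -
  have "lfsum (\<lambda>y. pderiv x' (Var x) * pderiv y G * var_bracket q N x' y) = 0" if "x' \<noteq> x" for x'
    using that by (simp add: pderiv_Var)
  then have "bracket q N (Var x) G =
      (\<Sum>x'\<in>{x}. lfsum (\<lambda>y. pderiv x' (Var x) * pderiv y G * var_bracket q N x' y))"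
    unfolding bracket_def lfsum_pair(1)[OF lfin_bracket[OF mode_Var assms]] prod.case
    by (intro lfsum_eq_sum) auto
  then show ?thesis by (simp add: pderiv_Var)
qed

text \<open>Chain rule in the first argument; it reduces brackets of hamiltonians to brackets of a
  single variable with a hamiltonian.\<close>

lemma bracket_expand:
  assumes "mode w F = F" "mode v G = G"
  shows "bracket q N F G = lfsum (\<lambda>x. pderiv x F * bracket q N (Var x) G)"
    and "lfin (\<lambda>x. pderiv x F * bracket q N (Var x) G)"
proof -
  have eq: "pderiv x F * bracket q N (Var x) G = lfsum (\<lambda>y. pderiv x F * pderiv y G * var_bracket q N x y)" for x
    unfolding bracket_Var_left[OF assms(2)] by (subst lfsum_mult[OF lfin_bracket_Var[OF assms(2)]]) (simp add: mult.assoc)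
  show "bracket q N F G = lfsum (\<lambda>x. pderiv x F * bracket q N (Var x) G)"
    unfolding eq unfolding bracket_def lfsum_pair(1)[OF lfin_bracket[OF assms]] prod.case ..
  show "lfin (\<lambda>x. pderiv x F * bracket q N (Var x) G)"
    using lfin_lfsum[OF lfin_bracket[OF assms, of q N]] unfolding eq prod.case .
qed

lemma lfsum_var:
  assumes "lfin f" and "finite A" and "\<And>k b. k \<notin> A \<Longrightarrow> f (k, b) = 0"
  shows "lfsum f = (\<Sum>k\<in>A. lfsum (\<lambda>b. f (k, b)))"
  unfolding lfsum_pair(1)[OF assms(1)]
proof (rule lfsum_eq_sum[OF assms(2)])
  fix k assume "k \<notin> A"
  then show "lfsum (\<lambda>b. f (k, b)) = 0" using assms(3) by simp
qed

text \<open>The sign and the \<open>- m\<close> express antisymmetry together with the exchange of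
  \<open>z\<close> and \<open>w\<close>, so that one formula serves both orders of the
  indices.\<close>

definition kern :: "complex \<Rightarrow> nat \<Rightarrow> nat \<Rightarrow> nat \<Rightarrow> int \<Rightarrow> complex" where
  "kern q N i j m = (if i \<le> j then kernel q N i j m else - kernel q N j i (- m))"

lemma Const_uminus: "Const (- c) = - Const c"
  by (rule lser_eqI) (auto simp: Const.rep_eq uminus_lser.rep_eq)

lemma var_bracket_kern:
  "var_bracket q N (i, a) (j, b) = lfsum (\<lambda>m. Const (kern q N i j m) * (Var (i, a - m) * Var (j, b + m)))"
proof (cases "i \<le> j")
  case False
  have "lfsum (\<lambda>m. Const (kern q N i j m) * (Var (i, a - m) * Var (j, b + m))) =
    lfsum (\<lambda>m. - (Const (kernel q N j i m) * (Var (j, b - m) * Var (i, a + m))))"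
    by (subst lfsum_uminus_index[symmetric])
       (simp add: kern_def False Const_uminus mult.commute mult.left_commute)
  then show ?thesis using False by (simp add: var_bracket_def var_bracket_le_def lfsum_minus)
qed (simp add: var_bracket_def var_bracket_le_def kern_def)

text \<open>Up to sign \<open>X j\<close> is a variational derivative. Since the bracket is
  quadratic in the variables, summing over \<open>b\<close> convolves \<open>X j\<close> with
  \<open>Lam j\<close>, and only modes of \<open>Lam j * X j\<close> remain.\<close>

lemma bracket_Var_Lam_gradient:
  assumes H: "mode v H = H"
    and d: "\<And>j b. j \<in> {1..N} \<Longrightarrow> pderiv (j, b) H = - mode (- b) (X j)"
    and d0: "\<And>j b. j \<notin> {1..N} \<Longrightarrow> pderiv (j, b) H = 0"
  shows "bracket q N (Var (i, a)) H =
    - lfsum (\<lambda>m. Var (i, a - m) * (\<Sum>j\<in>{1..N}. Const (kern q N i j m) * mode m (Lam j * X j)))"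
proof -
  have summand: "lfsum (\<lambda>b. pderiv (j, b) H * var_bracket q N (i, a) (j, b)) =
      - lfsum (\<lambda>m. Var (i, a - m) * (Const (kern q N i j m) * mode m (Lam j * X j)))"
    if j: "j \<in> {1..N}" for j
  proof -
    let ?f = "\<lambda>b m. mode (- b) (X j) * (Var (i, a - m) * (Const (kern q N i j m) * Var (j, b + m)))"
    have fin: "lfin (\<lambda>(b, m). ?f b m)" by (rule lfin_mode_Var_mult)
    have "pderiv (j, b) H * var_bracket q N (i, a) (j, b) = - lfsum (?f b)" for b
    proof -
      have eq: "Const (kern q N i j m) * (Var (i, a - m) * Var (j, b + m)) =
        Var (i, a - m) * (Const (kern q N i j m) * Var (j, b + m))" for m
        by (simp add: mult.left_commute)
      show ?thesis unfolding var_bracket_kern d[OF j] eq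
        by (simp add: lfsum_mult[OF lfin_Var_mult] lfsum_minus)
    qed
    then have "lfsum (\<lambda>b. pderiv (j, b) H * var_bracket q N (i, a) (j, b)) =
        - lfsum (\<lambda>b. lfsum (?f b))" by (simp add: lfsum_minus)
    moreover have "lfsum (\<lambda>b. lfsum (?f b)) = lfsum (\<lambda>m. lfsum (\<lambda>b. ?f b m))"
      using lfsum_pair[OF fin] by simp
    moreover have "lfsum (\<lambda>b. ?f b m) = Var (i, a - m) * (Const (kern q N i j m) * mode m (Lam j * X j))" for m
    proof -
      have "mode m (Lam j * X j) = lfsum (\<lambda>b. mode (- b) (X j) * Var (j, b + m))"
        by (subst mult.commute) (simp add: mode_mult' mode_Lam add.commute)
      then have "(Var (i, a - m) * Const (kern q N i j m)) * mode m (Lam j * X j) =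
        lfsum (\<lambda>b. (Var (i, a - m) * Const (kern q N i j m)) * (mode (- b) (X j) * Var (j, b + m)))"
        by (simp add: lfsum_mult[OF lfin_mode_mult])
      then show ?thesis by (simp add: mult.assoc mult.left_commute)
    qed
    ultimately show ?thesis by simp
  qed
  have "bracket q N (Var (i, a)) H =
      (\<Sum>j\<in>{1..N}. lfsum (\<lambda>b. pderiv (j, b) H * var_bracket q N (i, a) (j, b)))"
    unfolding bracket_Var_left[OF H] by (rule lfsum_var[OF lfin_bracket_Var[OF H]]) (simp_all add: d0)
  also have "\<dots> = - (\<Sum>j\<in>{1..N}. lfsum (\<lambda>m. Var (i, a - m) * (Const (kern q N i j m) * mode m (Lam j * X j))))"
    by (simp add: summand sum_negf)
  also have "\<dots> = - lfsum (\<lambda>m. Var (i, a - m) * (\<Sum>j\<in>{1..N}. Const (kern q N i j m) * mode m (Lam j * X j)))"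
    by (subst lfsum_sum) (simp_all add: lfin_Var_mult sum_distrib_left)
  finally show ?thesis .
qed

text \<open>
  The kernel depends on \<open>i - j\<close> modulo \<open>N\<close> only. Up to the common denominator, the sum over
  \<open>j \<noteq> i\<close> telescopes along this cycle from \<open>A (i + 1)\<close> to \<open>A i\<close>.
\<close>

lemma kern_sum:
  fixes g A :: "nat \<Rightarrow> complex"
  assumes q: "q \<noteq> 0" "\<And>k::nat. k \<ge> 1 \<Longrightarrow> q ^ k \<noteq> 1" and i: "i \<in> {1..N}"
    and g: "\<And>j. j \<in> {1..N} \<Longrightarrow> (q powi (- m) - 1) * g j = A j - q powi (- m) * A (Suc j)"
    and per: "A (Suc N) = A 1"
  shows "(\<Sum>j\<in>{1..N}. kern q N i j m * g j) = A i - A (Suc i)"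
proof (cases "m = 0")
  case True
  then have "kern q N i j m = 0" for j by (simp add: kern_def kernel_def)
  \<comment> \<open>For \<open>m = 0\<close> the factor of \<open>g i\<close> vanishes, so the
    relation itself gives \<open>A i = A (Suc i)\<close>.\<close>
  then show ?thesis using g[OF i] True by simp
next
  case False
  define Q where "Q = q powi m"
  have Q0: "Q \<noteq> 0" using q(1) by (simp add: Q_def)
  have QN: "q powi (m * int N) = Q ^ N" by (simp add: Q_def power_int_mult)
  have Q1: "Q \<noteq> 1" using generic_powi_neq_1[OF q False] by (simp add: Q_def)
  have QN1: "Q ^ N \<noteq> 1" using generic_powi_neq_1[OF q, of "m * int N"] False i QN by auto
  \<comment> \<open>Multiplying the relation by \<open>Q\<close> clears the negative powers.\<close>
  have gQ: "(1 - Q) * g j = Q * A j - A (Suc j)" if "j \<in> {1..N}" for j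
  proof -
    have "(inverse Q - 1) * g j = A j - inverse Q * A (Suc j)"
      using g[OF that] by (simp add: Q_def power_int_minus)
    then show ?thesis using Q0 by (simp add: field_simps)
  qed
  have pow: "q powi (m * k) = Q ^ nat k" if "k \<ge> 0" for k
    using that by (simp add: Q_def power_int_mult) (metis int_nat_eq power_int_of_nat)
  let ?D = "1 - Q ^ N"
  have PN0: "Q ^ N \<noteq> 0" using Q0 by simp
  have diag: "?D * (kern q N i i m * g i) = (1 - Q ^ (N - 1)) * (Q * A i - A (Suc i))"
  proof -
    have "q powi (m * (int N - 1)) = Q ^ (N - 1)" using pow[of "int N - 1"] i by (simp add: nat_diff_distrib)
    then have "kern q N i i m = (1 - Q) * (1 - Q ^ (N - 1)) / ?D"
      using False by (simp add: kern_def kernel_def QN) (simp add: Q_def)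
    then have "?D * (kern q N i i m * g i) = (1 - Q ^ (N - 1)) * ((1 - Q) * g i)"
      using QN1 by simp
    then show ?thesis using gQ[OF i] by simp
  qed
  have lo: "?D * (kern q N i j m * g j) = (1 - Q) * (Q ^ (i - Suc j) * A (Suc j) - Q ^ (i - j) * A j)"
    if j: "j \<in> {1..<i}" for j
  proof -
    have e: "i - j = Suc (i - Suc j)" using j by auto
    \<comment> \<open>For \<open>j < i\<close> antisymmetry puts \<open>- m\<close> into the kernel.
      The factors \<open>Q^2\<close> and \<open>Q^(-N)\<close> are split off to turn
      \<open>(1 - 1/Q)^2\<close> and \<open>1 - 1/Q^N\<close> into polynomials in
      \<open>Q\<close>.\<close>
    have "q powi (- m * (int N + int j - int i - 1)) = q powi (m * (int i - int j - 1) + m * 2 - m * int N)"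
      by (rule arg_cong[of _ _ "power_int q"]) (simp add: algebra_simps)
    also have "\<dots> = Q ^ (i - Suc j) * Q ^ 2 / Q ^ N"
      using pow[of "int i - int j - 1"] pow[of 2] j q(1)
      by (simp add: power_int_add power_int_diff QN nat_diff_distrib)
    finally have "kern q N i j m = Q ^ (i - Suc j) * Q ^ 2 / Q ^ N * (1 - inverse Q)\<^sup>2 / (1 - inverse (Q ^ N))"
      using False j QN by (simp add: kern_def kernel_def power_int_minus) (simp add: Q_def)
    moreover have "Q ^ 2 * (1 - inverse Q)\<^sup>2 = (1 - Q)\<^sup>2"
      using Q0 by (simp add: field_simps power2_eq_square)
    moreover have "Q ^ N * (1 - inverse (Q ^ N)) = - ?D" using PN0 by (simp add: field_simps)
    ultimately have "kern q N i j m = Q ^ (i - Suc j) * (1 - Q)\<^sup>2 / (- ?D)"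
      by (metis (no_types, opaque_lifting) divide_divide_eq_left mult.assoc times_divide_eq_left)
    then have "- ?D * kern q N i j m = Q ^ (i - Suc j) * (1 - Q)\<^sup>2"
      using QN1 by (metis eq_iff_diff_eq_0 neg_equal_0_iff_equal nonzero_mult_div_cancel_left times_divide_eq_right)
    then have "?D * kern q N i j m = - (Q ^ (i - Suc j) * (1 - Q)\<^sup>2)" by (simp only: minus_mult_left) (metis minus_minus minus_mult_left)
    then have "?D * (kern q N i j m * g j) = - (Q ^ (i - Suc j) * (1 - Q)) * ((1 - Q) * g j)"
      unfolding mult.assoc[symmetric] by (simp add: power2_eq_square)
    moreover have "j \<in> {1..N}" using j i by auto
    ultimately show ?thesis unfolding gQ[OF \<open>j \<in> {1..N}\<close>] e by (simp add: algebra_simps)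
  qed
  have hi: "?D * (kern q N i j m * g j) =
      (1 - Q) * (Q ^ (N + i - Suc j) * A (Suc j) - Q ^ (N + i - j) * A j)"
    if j: "j \<in> {Suc i..<Suc N}" for j
  proof -
    have e: "N + i - j = Suc (N + i - Suc j)" using j i by auto
    have "nat (int N + int i - int j - 1) = N + i - Suc j" using j i by auto
    then have "q powi (m * (int N + int i - int j - 1)) = Q ^ (N + i - Suc j)"
      using pow[of "int N + int i - int j - 1"] j i by simp
    then have "kern q N i j m = - (Q ^ (N + i - Suc j) * (1 - Q)\<^sup>2) / ?D"
      using False j by (simp add: kern_def kernel_def QN) (simp add: Q_def)
    then have "?D * (kern q N i j m * g j) = - (Q ^ (N + i - Suc j) * (1 - Q)) * ((1 - Q) * g j)"
      using QN1 by (simp add: power2_eq_square)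
    moreover have "j \<in> {1..N}" using j i by auto
    ultimately show ?thesis unfolding gQ[OF \<open>j \<in> {1..N}\<close>] e by (simp add: algebra_simps)
  qed
  have "?D * (\<Sum>j\<in>{1..N}. kern q N i j m * g j) = (\<Sum>j\<in>{1..N}. ?D * (kern q N i j m * g j))"
    by (rule sum_distrib_left)
  \<comment> \<open>The exponent of \<open>Q\<close> at \<open>A j\<close> is \<open>i - j\<close>
    before \<open>i\<close> and \<open>N + i - j\<close> after it, so both ranges telescope; their
    boundary terms at \<open>A 1\<close> and \<open>A (Suc N)\<close> cancel by
    \<open>per\<close>.\<close>
  also have "\<dots> = (\<Sum>j\<in>{1..<i} \<union> {i} \<union> {Suc i..<Suc N}. ?D * (kern q N i j m * g j))"
    by (rule sum.cong) (use i in auto)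
  also have "(\<Sum>j\<in>{1..<i} \<union> {i} \<union> {Suc i..<Suc N}. ?D * (kern q N i j m * g j)) =
      (\<Sum>j\<in>{1..<i}. ?D * (kern q N i j m * g j)) + ?D * (kern q N i i m * g i) +
      (\<Sum>j\<in>{Suc i..<Suc N}. ?D * (kern q N i j m * g j))"
    by (subst sum.union_disjoint; (subst sum.union_disjoint)?) auto
  also have "(\<Sum>j\<in>{1..<i}. ?D * (kern q N i j m * g j)) = (1 - Q) * (A i - Q ^ (i - 1) * A 1)"
    using i sum_Suc_diff'[of 1 i "\<lambda>j. Q ^ (i - j) * A j"] by (simp add: lo flip: sum_distrib_left)
  also have "(\<Sum>j\<in>{Suc i..<Suc N}. ?D * (kern q N i j m * g j)) =
      (1 - Q) * (Q ^ (i - 1) * A 1 - Q ^ (N - 1) * A (Suc i))"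
    using i sum_Suc_diff'[of "Suc i" "Suc N" "\<lambda>j. Q ^ (N + i - j) * A j"]
    by (simp add: hi per flip: sum_distrib_left del: sum.op_ivl_Suc)
  also have "(1 - Q) * (A i - Q ^ (i - 1) * A 1) + ?D * (kern q N i i m * g i) +
      (1 - Q) * (Q ^ (i - 1) * A 1 - Q ^ (N - 1) * A (Suc i)) = (1 - Q * Q ^ (N - 1)) * (A i - A (Suc i))"
    unfolding diag by (simp add: algebra_simps)
  also have "Q * Q ^ (N - 1) = Q ^ N" using i by (simp flip: power_Suc)
  finally show ?thesis using QN1 by simp
qed

section \<open>The roots of the operators \<open>L\<^sub>i\<close>\<close>

definition lconst :: "lser \<Rightarrow> lfam" where
  "lconst f = Lfam (\<lambda>_. f)"

lemma at_q_lconst [simp]: "at_q (lconst f) q = f"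
  by (simp add: lconst_def Lfam_inverse)

text \<open>The index is unrestricted and reduced modulo \<open>N\<close> only inside
  \<open>Lam\<close>, so that later relations can use \<open>Suc i\<close> without a wrap-around
  case.\<close>

definition fac :: "nat \<Rightarrow> nat \<Rightarrow> lfam skew" where
  "fac N i = monom 1 1 - monom (lconst (Lam (cyc N i))) 0"

lemma cf_fac_mult: "cf (fac N i * R) n = sh 1 (cf R (n - 1)) - lconst (Lam (cyc N i)) * cf R n"
  by (simp add: fac_def left_diff_distrib cf_monom_mult)

lemma cf_mult_fac: "cf (R * fac N i) n = cf R (n - 1) - cf R n * sh n (lconst (Lam (cyc N i)))"
  by (simp add: fac_def right_diff_distrib cf_mult_monom)

lemma cyc_bounds: "0 < N \<Longrightarrow> cyc N i \<in> {1..N}"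
  by (simp add: cyc_def Suc_le_eq less_imp_le)

lemma cyc_id: "i \<in> {1..N} \<Longrightarrow> cyc N i = i"
  by (cases "i = N") (auto simp: cyc_def)

lemma cyc_cyc_add: "cyc N (cyc N i + k) = cyc N (i + k)"
proof -
  have "(cyc N i + k) mod N = (i + k) mod N" by (rule mod_add_cong) (simp_all add: cyc_def)
  then show ?thesis by (simp add: cyc_def[of N "cyc N i + k"] cyc_def[of N "i + k"])
qed

lemma cyc_add_self: "cyc N (i + N) = cyc N i"
  by (simp add: cyc_def)

lemma fac_cyc: "fac N (cyc N i + k) = fac N (i + k)"
  by (simp add: fac_def cyc_cyc_add)

lemma fac_add_self: "fac N (i + N) = fac N i"
  by (simp add: fac_def cyc_add_self)

definition J_fam :: "nat \<Rightarrow> lfam set" where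
  "J_fam N = {f. \<forall>q. at_q f q \<in> J_ring (Rep_generic q) N}"

lemma Const_1: "Const 1 = 1"
  by (rule lser_eqI) (simp add: Const.rep_eq one_lser.rep_eq)

lemma J_ring_diff: "R \<in> J_ring q N \<Longrightarrow> S \<in> J_ring q N \<Longrightarrow> R - S \<in> J_ring q N"
  using J_add[OF _ J_mult[OF J_const[of "- 1"]], of R q N S] by (simp add: Const_uminus Const_1)

lemma J_ring_1: "1 \<in> J_ring q N"
  using J_const[of 1] by (simp add: Const_1)

lemma difference_subring_J_fam: "difference_subring N (J_fam N)"
  unfolding difference_subring_def J_fam_def
proof (intro conjI ballI allI impI CollectI; (elim CollectE)?)
  fix x q assume "\<forall>q. at_q (\<Sum>k<N. sh (int k) x) q \<in> J_ring (Rep_generic q) N"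
  then have "(\<Sum>k<N. shift (Rep_generic q) (int k) (at_q x q)) \<in> J_ring (Rep_generic q) N"
    by (simp add: at_q_sum at_q_sh)
  then show "at_q x q \<in> J_ring (Rep_generic q) N" by (rule J_solve)
qed (simp_all add: J_ring_1 J_ring_diff J_mult J_shift at_q_sh)

lemma coeffs_in_fac:
  assumes "0 < N"
  shows "coeffs_in (J_fam N) (fac N i)"
proof -
  note J = difference_subringD[OF difference_subring_J_fam[of N]]
  have "lconst (Lam (cyc N i)) \<in> J_fam N"
    using cyc_bounds[OF assms] by (simp add: J_fam_def J_Lam)
  then show ?thesis using J(3)[OF J(1)] by (auto simp: coeffs_in_def fac_def J(1,2))
qed

lemma monic_fac: "monic 1 (fac N i)"
  by (simp add: monic_def ord_le_def fac_def)

definition Lprod :: "nat \<Rightarrow> nat \<Rightarrow> lfam skew" where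
  "Lprod N i = (\<Prod>k\<leftarrow>[0..<N]. fac N (i + k))"

lemma monic_Lprod: "monic (int N) (Lprod N i)"
proof -
  have "monic (int l) (\<Prod>k\<leftarrow>[0..<l]. fac N (i + k))" for l
    by (induction l) (auto simp: monic_1 add.commute dest: monic_mult[OF _ monic_fac])
  then show ?thesis by (simp add: Lprod_def)
qed

lemma coeffs_in_Lprod:
  assumes "0 < N"
  shows "coeffs_in (J_fam N) (Lprod N i)"
proof -
  note J = difference_subring_J_fam[of N]
  have "coeffs_in (J_fam N) (\<Prod>k\<leftarrow>[0..<l]. fac N (i + k))" for l
    by (induction l) (auto simp: coeffs_in_1[OF J] intro: coeffs_in_mult[OF J] coeffs_in_fac[OF assms])
  then show ?thesis by (simp add: Lprod_def)
qed

lemma Lprod_cyc: "Lprod N (cyc N i) = Lprod N i"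
  by (simp add: Lprod_def fac_cyc)

text \<open>Both sides are the product of \<open>N + 1\<close> consecutive factors, since by
  periodicity the last one is again \<open>fac N i\<close>.\<close>

lemma Lprod_intertwine: "Lprod N i * fac N i = fac N i * Lprod N (Suc i)"
proof -
  have "Lprod N i * fac N i = (\<Prod>k\<leftarrow>[0..<Suc N]. fac N (i + k))"
    by (simp add: Lprod_def fac_add_self)
  also have "[0..<Suc N] = 0 # map Suc [0..<N]" by (simp add: upt_conv_Cons map_Suc_upt del: upt_Suc)
  also have "(\<Prod>k\<leftarrow>0 # map Suc [0..<N]. fac N (i + k)) = fac N i * Lprod N (Suc i)"
    by (simp add: Lprod_def o_def)
  finally show ?thesis .
qed

definition Lroot :: "nat \<Rightarrow> nat \<Rightarrow> lfam skew" where
  "Lroot N i = (SOME P. monic 1 P \<and> coeffs_in (J_fam N) P \<and> P ^ N = Lprod N i)"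

lemma Lroot_props:
  assumes "0 < N"
  shows "monic 1 (Lroot N i)" "coeffs_in (J_fam N) (Lroot N i)" "Lroot N i ^ N = Lprod N i"
proof -
  obtain P where "monic 1 P \<and> coeffs_in (J_fam N) P \<and> P ^ N = Lprod N i"
    using root_exists[OF difference_subring_J_fam assms monic_Lprod coeffs_in_Lprod[OF assms]] by metis
  then have "monic 1 (Lroot N i) \<and> coeffs_in (J_fam N) (Lroot N i) \<and> Lroot N i ^ N = Lprod N i"
    unfolding Lroot_def by (rule someI)
  then show "monic 1 (Lroot N i)" "coeffs_in (J_fam N) (Lroot N i)" "Lroot N i ^ N = Lprod N i" by auto
qed

text \<open>The choice made in \<open>Lroot\<close> depends on \<open>i\<close> only through
  \<open>Lprod N i\<close>, so periodicity is inherited.\<close>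

lemma Lroot_cyc: "Lroot N (cyc N i) = Lroot N i"
  by (simp add: Lroot_def Lprod_cyc)

lemma Lroot_add_self: "Lroot N (i + N) = Lroot N i"
  using Lroot_cyc[of N "i + N"] Lroot_cyc[of N i] by (simp only: cyc_add_self)

lemma Lroot_fac:
  assumes "0 < N"
  shows "Lroot N i * fac N i = fac N i * Lroot N (Suc i)"
  by (rule root_intertwine[OF Lroot_props(1)[OF assms] Lroot_props(1)[OF assms] assms])
     (simp add: Lroot_props(3)[OF assms] Lprod_intertwine)

lemma Lroot_power_fac:
  assumes "0 < N"
  shows "Lroot N i ^ n * fac N i = fac N i * Lroot N (Suc i) ^ n"
proof (induction n)
  case (Suc n)
  have "Lroot N i ^ Suc n * fac N i = Lroot N i * (fac N i * Lroot N (Suc i) ^ n)"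
    by (simp add: mult.assoc Suc)
  also have "\<dots> = fac N i * Lroot N (Suc i) * Lroot N (Suc i) ^ n"
    by (simp add: Lroot_fac[OF assms] flip: mult.assoc)
  finally show ?case by (simp add: mult.assoc)
qed simp

definition fac_inv :: "nat \<Rightarrow> nat \<Rightarrow> lfam skew" where
  "fac_inv N i = (SOME b. fac N i * b = 1 \<and> b * fac N i = 1)"

lemma fac_inv: "fac N i * fac_inv N i = 1" "fac_inv N i * fac N i = 1"
proof -
  obtain b where "fac N i * b = 1 \<and> b * fac N i = 1"
    using linear_invertible[of "lconst (Lam (cyc N i))"] unfolding fac_def by metis
  then have "fac N i * fac_inv N i = 1 \<and> fac_inv N i * fac N i = 1"
    unfolding fac_inv_def by (rule someI)
  then show "fac N i * fac_inv N i = 1" "fac_inv N i * fac N i = 1" by auto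
qed

text \<open>Up to sign, the residue of this operator is the variational derivative of
  \<open>H\<^sub>n\<close> with respect to \<open>\<Lambda>\<^sub>i\<close>.\<close>

definition grad :: "nat \<Rightarrow> nat \<Rightarrow> nat \<Rightarrow> lfam skew" where
  "grad N n i = fac_inv N i * Lroot N i ^ n"

lemma fac_grad: "fac N i * grad N n i = Lroot N i ^ n"
  by (simp add: grad_def fac_inv flip: mult.assoc)

lemma grad_fac:
  assumes "0 < N"
  shows "grad N n i * fac N i = Lroot N (Suc i) ^ n"
proof -
  have "grad N n i * fac N i = fac_inv N i * (fac N i * Lroot N (Suc i) ^ n)"
    by (simp add: grad_def mult.assoc Lroot_power_fac[OF assms])
  then show ?thesis by (simp add: fac_inv flip: mult.assoc)
qed

lemma fac_inv_add_self: "fac_inv N (i + N) = fac_inv N i"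
  by (simp add: fac_inv_def fac_add_self)

lemma grad_add_self: "grad N n (i + N) = grad N n i"
  by (simp add: grad_def fac_inv_add_self Lroot_add_self)

section \<open>The Lax flow and sums over a period\<close>

definition skew_pos :: "'a::zero skew \<Rightarrow> 'a skew" where
  "skew_pos R = Skew (\<lambda>n. if n \<ge> 0 then cf R n else 0)"

lemma cf_skew_pos: "cf (skew_pos R) n = (if n \<ge> 0 then cf R n else 0)"
proof -
  obtain M where "\<forall>n>M. cf R n = 0" using cf[of R] by auto
  then have "\<exists>M. \<forall>n>M. (if n \<ge> 0 then cf R n else 0) = 0" by (intro exI[of _ M]) simp
  then show ?thesis by (simp add: skew_pos_def Skew_inverse)
qed

definition flow :: "nat \<Rightarrow> nat \<Rightarrow> nat \<Rightarrow> lfam" where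
  "flow N n i = lconst (Lam (cyc N i)) * (cf (Lroot N (Suc i) ^ n) 0 - cf (Lroot N i ^ n) 0)"

text \<open>Without truncation the two products agree. At positive orders truncation changes
  nothing, at negative orders both products vanish, and at order 0 the dropped coefficient of
  \<open>D^(-1)\<close> leaves only the terms containing \<open>Lam\<close>.\<close>

lemma lax_flow:
  assumes "0 < N"
  shows "fac N i * skew_pos (Lroot N (Suc i) ^ n) - skew_pos (Lroot N i ^ n) * fac N i = monom (- flow N n i) 0"
proof (rule skew_eqI)
  fix m
  have "cf (fac N i * Lroot N (Suc i) ^ n) m = cf (Lroot N i ^ n * fac N i) m"
    by (simp add: Lroot_power_fac[OF assms])
  then show "cf (fac N i * skew_pos (Lroot N (Suc i) ^ n) - skew_pos (Lroot N i ^ n) * fac N i) m =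
    cf (monom (- flow N n i) 0) m"
    by (auto simp: cf_fac_mult cf_mult_fac cf_skew_pos flow_def algebra_simps)
qed

lemma sum_periodic:
  fixes f :: "nat \<Rightarrow> 'b::ab_group_add"
  assumes "\<And>i. f (i + N) = f i"
  shows "(\<Sum>j<N. f (i + j)) = (\<Sum>j\<in>{1..N}. f j)"
proof -
  have step: "(\<Sum>j<N. f (Suc i + j)) = (\<Sum>j<N. f (i + j))" for i
    using sum.lessThan_Suc_shift[of "\<lambda>j. f (i + j)" N] assms[of i] by simp
  have "(\<Sum>j<N. f (i + j)) = (\<Sum>j<N. f (0 + j))" for i
    by (induction i) (simp, metis step)
  then have "(\<Sum>j<N. f (i + j)) = (\<Sum>j<N. f (1 + j))" by metis
  also have "\<dots> = (\<Sum>j\<in>{1..N}. f j)"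
    by (rule sum.reindex_bij_witness[of _ "\<lambda>j. j - 1" Suc]) auto
  finally show ?thesis .
qed

section \<open>Evaluation at a generic \<open>q\<close>\<close>

definition op_at :: "generic \<Rightarrow> lfam skew \<Rightarrow> qop" where
  "op_at q R = (\<lambda>n. at_q (cf R n) q)"

lemma op_at_eqI: "(\<And>q. op_at q R = op_at q S) \<Longrightarrow> R = S"
  by (intro skew_eqI lfam_eqI) (simp add: op_at_def fun_eq_iff)

lemma op_at_mult: "op_at q (R * S) = op_mult (Rep_generic q) (op_at q R) (op_at q S)"
proof
  fix n
  obtain a where a: "ord_le a R" by (rule ord_leE)
  obtain b where b: "ord_le b S" by (rule ord_leE)
  have "op_at q (R * S) n = (\<Sum>k\<in>{n - b..a}. at_q (cf R k * sh k (cf S (n - k))) q)"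
    unfolding op_at_def cf_mult[OF a b order_refl order_refl] at_q_sum ..
  also have "\<dots> = Sum_any (\<lambda>k. at_q (cf R k * sh k (cf S (n - k))) q)"
  proof (rule Sum_any.expand_superset[symmetric], simp, clarify)
    fix k assume "at_q (cf R k * sh k (cf S (n - k))) q \<noteq> 0"
    then have "cf R k * sh k (cf S (n - k)) \<noteq> 0" by (metis zero_lfam.rep_eq)
    then show "k \<in> {n - b..a}"
      using skew_product_support[of a "cf R" b "cf S" n] a b by (auto simp: ord_le_def)
  qed
  finally show "op_at q (R * S) n = op_mult (Rep_generic q) (op_at q R) (op_at q S) n"
    by (simp add: op_mult_def op_at_def at_q_sh)
qed

lemma op_at_monom_0: "op_at q (monom f 0) = op_fun (at_q f q)"
  by (auto simp: op_at_def op_fun_def)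

lemma op_at_1: "op_at q 1 = op_fun 1"
  by (auto simp: op_at_def op_fun_def)

lemma op_at_power: "op_at q (R ^ n) = op_pow (Rep_generic q) (op_at q R) n"
  by (induction n) (simp_all add: op_pow_def op_at_1 op_at_mult)

lemma op_at_fac: "op_at q (fac N i) = D_minus_Lam (cyc N i)"
  by (auto simp: op_at_def fac_def D_minus_Lam_def)

lemma op_at_Lprod: "op_at q (Lprod N i) = Lop (Rep_generic q) N i"
proof -
  have "op_at q (\<Prod>k\<leftarrow>ks. fac N (i + k)) =
      foldr (\<lambda>k. op_mult (Rep_generic q) (D_minus_Lam (cyc N (i + k)))) ks (op_fun 1)" for ks
    by (induction ks) (simp_all add: op_at_1 op_at_mult op_at_fac)
  then show ?thesis by (simp add: Lprod_def Lop_def)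
qed

lemma op_at_pos: "op_at q (skew_pos R) = op_pos (op_at q R)"
  by (auto simp: op_at_def op_pos_def cf_skew_pos)

lemma op_at_diff: "op_at q (R - S) = (\<lambda>n. op_at q R n - op_at q S n)"
  by (simp add: op_at_def)

text \<open>Membership in \<open>I_ring\<close> comes from \<open>coeffs_in\<close>; uniqueness,
  which \<open>THE\<close> requires, from \<open>root_intertwine\<close> with
  \<open>W = 1\<close>.\<close>

lemma Pop_eq_root:
  assumes "0 < N"
  shows "Pop (Rep_generic q) N i = op_at q (Lroot N i)"
  unfolding Pop_def
proof (rule the_equality)
  note P = Lroot_props[OF assms, of i]
  have "op_at q (Lroot N i) \<in> I_ring (Rep_generic q) N"
    using P(1,2) by (auto simp: I_ring_def op_at_def coeffs_in_def J_fam_def monic_def ord_le_def intro: exI[of _ 1])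
  then show "op_at q (Lroot N i) \<in> I_ring (Rep_generic q) N \<and> op_at q (Lroot N i) 1 = 1 \<and>
    (\<forall>n>1. op_at q (Lroot N i) n = 0) \<and> op_pow (Rep_generic q) (op_at q (Lroot N i)) N = Lop (Rep_generic q) N i"
    using P(1) op_at_power[of q "Lroot N i" N] unfolding P(3) op_at_Lprod
    by (auto simp: op_at_def monic_def ord_le_def)
next
  fix P assume P: "P \<in> I_ring (Rep_generic q) N \<and> P 1 = 1 \<and> (\<forall>n>1. P n = 0) \<and>
    op_pow (Rep_generic q) P N = Lop (Rep_generic q) N i"
  note Q = Lroot_props[OF assms, of i]
  \<comment> \<open>Extend the competing root at \<open>q\<close> by the known roots at all other values of the parameter.\<close>
  define R where "R = Skew (\<lambda>n. Lfam (\<lambda>q'. if q' = q then P n else at_q (cf (Lroot N i) n) q'))"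
  have "cf R n = Lfam (\<lambda>q'. if q' = q then P n else at_q (cf (Lroot N i) n) q')" for n
    unfolding R_def
  proof (subst Skew_inverse, safe intro!: exI[of _ 1])
    fix n :: int assume "1 < n"
    then have "P n = 0" "cf (Lroot N i) n = 0" using P Q(1) by (auto simp: monic_def ord_le_def)
    then show "Lfam (\<lambda>q'. if q' = q then P n else at_q (cf (Lroot N i) n) q') = 0"
      by (intro lfam_eqI) (simp add: Lfam_inverse)
  qed
  then have at: "op_at q' R = (if q' = q then P else op_at q' (Lroot N i))" for q'
    by (auto simp: op_at_def Lfam_inverse)
  have cfR: "at_q (cf R n) q' = (if q' = q then P n else at_q (cf (Lroot N i) n) q')" for n q'
    using at[of q'] by (auto simp: op_at_def fun_eq_iff)
  have "monic 1 R"
    unfolding monic_def ord_le_def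
  proof (intro conjI allI impI lfam_eqI)
    fix n :: int and q' assume "1 < n"
    then show "at_q (cf R n) q' = at_q 0 q'" using P Q(1) by (auto simp: cfR monic_def ord_le_def)
  next
    fix q' show "at_q (cf R 1) q' = at_q 1 q'" using P Q(1) by (auto simp: cfR monic_def)
  qed
  moreover have "R ^ N = Lprod N i"
  proof (rule op_at_eqI)
    fix q'
    show "op_at q' (R ^ N) = op_at q' (Lprod N i)"
      using P op_at_power[of q' "Lroot N i" N] unfolding Q(3)
      by (cases "q' = q") (simp_all add: op_at_power op_at_Lprod at)
  qed
  ultimately have "R = Lroot N i"
    using root_intertwine[of R "Lroot N i" N 1] Q(1,3) assms by simp
  then show "P = op_at q (Lroot N i)" using at[of q] by simp
qed

section \<open>Variational derivatives of the hamiltonians\<close>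

definition euler_fam :: "var \<Rightarrow> lfam \<Rightarrow> lfam" where
  "euler_fam x f = Lfam (\<lambda>q. euler x (at_q f q))"

lemma at_q_euler_fam [simp]: "at_q (euler_fam x f) q = euler x (at_q f q)"
  by (simp add: euler_fam_def Lfam_inverse)

lemma euler_0 [simp]: "euler x 0 = 0"
  using euler_add[of x 0 0] by simp

lemma euler_1 [simp]: "euler x 1 = 0"
  using euler_mult[of x 1 1] by simp

text \<open>\<open>mode 0\<close> is invariant under shifts, and the Euler derivation commutes with
  them.\<close>

lemma trace_derivation_at:
  "trace_derivation (\<lambda>R. mode 0 (at_q (cf R 0) q)) (skew_map (euler_fam x))"
  by (rule residue_trace_derivation[where I = "\<lambda>f. mode 0 (at_q f q)"])
     (auto intro: lfam_eqI simp: mode_add at_q_sh mode_0_shift euler_add euler_mult euler_shift)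

lemma cf_skew_map_euler: "cf (skew_map (euler_fam x) R) n = euler_fam x (cf R n)"
  by (rule cf_skew_map) (auto intro: lfam_eqI)

lemma skew_map_fac: "skew_map (euler_fam x) (fac N i) = monom (- lconst (euler x (Lam (cyc N i)))) 0"
proof (intro skew_eqI lfam_eqI)
  fix n q
  have "euler x (- f) = - euler x f" for f
    using euler_add[of x f "- f"] by (simp add: eq_neg_iff_add_eq_0 add.commute)
  then show "at_q (cf (skew_map (euler_fam x) (fac N i)) n) q =
    at_q (cf (monom (- lconst (euler x (Lam (cyc N i)))) 0) n) q"
    by (auto simp: cf_skew_map_euler fac_def)
qed

lemma mode_zero [simp]: "mode m 0 = 0"
  using mode_diff[of m 0 0] by simp

definition res :: "generic \<Rightarrow> nat \<Rightarrow> nat \<Rightarrow> nat \<Rightarrow> lser" where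
  "res q N n i = at_q (cf (Lroot N i ^ n) 0) q"

definition vgrad :: "generic \<Rightarrow> nat \<Rightarrow> nat \<Rightarrow> nat \<Rightarrow> lser" where
  "vgrad q N n i = at_q (cf (grad N n i) 0) q"

section \<open>Matrix powers and the hamiltonians as sums of residues\<close>

lemma op_mult_0_left [simp]: "op_mult q (\<lambda>_. 0) R = (\<lambda>_. 0)"
  by (simp add: op_mult_def)

lemma op_mult_0_right [simp]: "op_mult q R (\<lambda>_. 0) = (\<lambda>_. 0)"
proof -
  have "shift q k 0 = 0" for k using shift_add[of q k 0 0] by simp
  then show ?thesis by (simp add: op_mult_def)
qed

lemma op_fun_0 [simp]: "op_fun 0 = (\<lambda>_. 0)"
  by (auto simp: op_fun_def)

lemma mat_pow_diag:
  assumes "i \<in> {1..N}"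
  shows "mat_pow q N (mat_diag d) n i j = (if i = j then op_pow q (d i) n else (\<lambda>_. 0))"
proof (induction n)
  case (Suc n)
  have "mat_pow q N (mat_diag d) (Suc n) i j =
      (\<lambda>m. \<Sum>k\<in>{1..N}. op_mult q (mat_diag d i k) (mat_pow q N (mat_diag d) n k j) m)"
    by (simp add: mat_pow_def mat_mult_def)
  also have "\<dots> = (\<lambda>m. \<Sum>k\<in>{1..N}. if k = i then op_mult q (d i) (mat_pow q N (mat_diag d) n i j) m else 0)"
    by (intro ext sum.cong) (auto simp: mat_diag_def)
  also have "\<dots> = op_mult q (d i) (mat_pow q N (mat_diag d) n i j)"
    using assms by simp
  finally show ?case using Suc by (simp add: op_pow_def)
qed (simp add: mat_pow_def mat_diag_def op_pow_def)

lemma res_eq_op_pow: "res q N n i = op_pow (Rep_generic q) (op_at q (Lroot N i)) n 0"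
  by (simp flip: op_at_power) (simp add: res_def op_at_def)

lemma Ham_eq:
  assumes "0 < N"
  shows "Ham (Rep_generic q) N n = Const (1 / of_nat n) * (\<Sum>i\<in>{1..N}. mode 0 (res q N n i))"
proof -
  have "mat_trace_Res N (mat_pow (Rep_generic q) N (Pmat (Rep_generic q) N) n) = (\<Sum>i\<in>{1..N}. res q N n i)"
    unfolding mat_trace_Res_def Pmat_def
    by (rule sum.cong) (simp_all add: mat_pow_diag Pop_eq_root[OF assms] op_Res_def res_eq_op_pow)
  then show ?thesis by (simp add: Ham_def mode_sum)
qed

lemma Const_inverse_mult:
  assumes "0 < k"
  shows "Const (1 / of_nat k) * (of_nat k * f) = f"
proof -
  have "coeff (of_nat k * f) \<mu> = of_nat k * coeff f \<mu>" for \<mu>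
    by (induction k) (simp_all add: plus_lser.rep_eq zero_lser.rep_eq distrib_right)
  then show ?thesis using assms by (intro lser_eqI) (simp add: coeff_Const_mult)
qed

text \<open>\<open>tr_root_variation\<close> is applied to the Euler derivation. Each of the
  \<open>N\<close> residues yields the same sum over a full period, so the factors \<open>N\<close>
  and \<open>n\<close> cancel; in that sum only the index \<open>k\<close> contributes.\<close>

lemma pderiv_Ham:
  assumes N: "0 < N" and n: "0 < n"
  shows "pderiv (k, b) (Ham (Rep_generic q) N n) =
    (if k \<in> {1..N} then - mode (- b) (vgrad q N n k) else 0)"
proof (rule pderiv_eqI)
  let ?x = "(k, b)"
  interpret trace_derivation "\<lambda>R. mode 0 (at_q (cf R 0) q)" "skew_map (euler_fam ?x)"
    by (rule trace_derivation_at)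
  let ?s = "\<lambda>j. - mode 0 (vgrad q N n j * euler ?x (Lam (cyc N j)))"
  let ?S = "\<Sum>j\<in>{1..N}. ?s j"
  have n': "n = Suc (n - 1)" using n by simp
  have s: "mode 0 (at_q (cf (fac_inv N j * Lroot N j ^ n * skew_map (euler_fam ?x) (fac N j)) 0) q) = ?s j" for j
    unfolding skew_map_fac grad_def[symmetric] cf_mult_monom by (simp add: vgrad_def mode_minus)
  have "of_nat N * mode 0 (euler ?x (res q N n i)) = of_nat n * ?S" for i
  proof -
    have "of_nat N * mode 0 (euler ?x (res q N n i)) = of_nat n * (\<Sum>j<N. ?s (i + j))"
      using tr_root_variation[of N "Lroot N" i "fac N" "fac_inv N" "n - 1"] n'
      by (simp add: N Lroot_props Lprod_def Lroot_add_self Lroot_fac fac_inv s cf_skew_map_euler res_def)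
    also have "(\<Sum>j<N. ?s (i + j)) = ?S"
      by (rule sum_periodic) (simp add: vgrad_def grad_add_self cyc_add_self)
    finally show ?thesis .
  qed
  then have "of_nat N * (\<Sum>i\<in>{1..N}. mode 0 (euler ?x (res q N n i))) = of_nat N * (of_nat n * ?S)"
    by (simp add: sum_distrib_left)
  then have "(\<Sum>i\<in>{1..N}. mode 0 (euler ?x (res q N n i))) = of_nat n * ?S"
    by (metis Const_inverse_mult[OF N])
  then have "euler ?x (Ham (Rep_generic q) N n) = ?S"
    by (simp only: Ham_eq[OF N] euler_Const_mult euler_sum euler_mode Const_inverse_mult[OF n])
  also have "?S = (\<Sum>j\<in>{1..N}. if j = k then - (Var ?x * mode (- b) (vgrad q N n k)) else 0)"
    by (rule sum.cong)
       (auto simp: cyc_id euler_Lam mode_Var_mult mult.commute[of "vgrad q N n k"])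
  also have "\<dots> = Var ?x * (if k \<in> {1..N} then - mode (- b) (vgrad q N n k) else 0)" by simp
  finally show "euler ?x (Ham (Rep_generic q) N n) =
    Var ?x * (if k \<in> {1..N} then - mode (- b) (vgrad q N n k) else 0)" .
qed

lemma mode_Ham: "mode 0 (Ham q N n) = Ham q N n"
  by (simp add: Ham_def mode_Const_mult)

text \<open>Here \<open>y\<close> is the coefficient of \<open>D^(-1)\<close> in
  \<open>grad\<close>, read off from the residues of \<open>fac * grad\<close> and
  \<open>grad * fac\<close>. Eliminating it gives the difference relation that
  \<open>kern_sum\<close> inverts.\<close>

lemma res_vgrad:
  assumes "0 < N"
  obtains y where "res q N n i = shift (Rep_generic q) 1 y - Lam (cyc N i) * vgrad q N n i"
    "res q N n (Suc i) = y - Lam (cyc N i) * vgrad q N n i"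
proof
  let ?y = "at_q (cf (grad N n i) (- 1)) q"
  show "res q N n i = shift (Rep_generic q) 1 ?y - Lam (cyc N i) * vgrad q N n i"
    unfolding res_def fac_grad[symmetric] cf_fac_mult by (simp add: vgrad_def at_q_sh)
  show "res q N n (Suc i) = ?y - Lam (cyc N i) * vgrad q N n i"
    unfolding res_def grad_fac[OF assms, symmetric] cf_mult_fac by (simp add: vgrad_def at_q_sh)
qed

text \<open>The gradient of the hamiltonian enters through \<open>Lam j * vgrad q N n j\<close>, on
  which the kernel sum collapses to a difference of neighbouring residues: the Lax flow.\<close>

lemma bracket_Var_Ham:
  assumes N: "0 < N" and n: "0 < n" and i: "i \<in> {1..N}"
  shows "bracket (Rep_generic q) N (Var (i, a)) (Ham (Rep_generic q) N n) =
    mode a (Lam i * (res q N n (Suc i) - res q N n i))"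
proof -
  let ?q = "Rep_generic q" and ?A = "res q N n" and ?g = "\<lambda>j. Lam j * vgrad q N n j"
  have sum: "(\<Sum>j\<in>{1..N}. Const (kern ?q N i j m) * mode m (?g j)) = mode m (?A i - ?A (Suc i))" for m
  proof (rule lser_eqI)
    fix \<mu>
    have "(\<Sum>j\<in>{1..N}. kern ?q N i j m * coeff (mode m (?g j)) \<mu>) =
      coeff (mode m (?A i)) \<mu> - coeff (mode m (?A (Suc i))) \<mu>"
    proof (rule kern_sum[OF generic i])
      fix j assume j: "j \<in> {1..N}"
      obtain y where y: "?A j = shift ?q 1 y - ?g j" "?A (Suc j) = y - ?g j"
        by (rule res_vgrad[OF N, of q n j, unfolded cyc_id[OF j]])
      \<comment> \<open>On mode \<open>m\<close> the shift by one is multiplication by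
        \<open>q powi (- m)\<close>, so the relation becomes scalar in each coefficient.\<close>
      show "(?q powi (- m) - 1) * coeff (mode m (?g j)) \<mu> =
          coeff (mode m (?A j)) \<mu> - ?q powi (- m) * coeff (mode m (?A (Suc j))) \<mu>"
        unfolding y by (simp add: mode_diff mode_shift coeff_Const_mult minus_lser.rep_eq)
          (simp add: algebra_simps)
    next
      show "coeff (mode m (?A (Suc N))) \<mu> = coeff (mode m (?A 1)) \<mu>"
        using Lroot_add_self[of N 1] by (simp add: res_def)
    qed
    then show "coeff (\<Sum>j\<in>{1..N}. Const (kern ?q N i j m) * mode m (?g j)) \<mu> =
        coeff (mode m (?A i - ?A (Suc i))) \<mu>"
      by (simp add: coeff_sum coeff_Const_mult mode_diff minus_lser.rep_eq)
  qed
  have "bracket ?q N (Var (i, a)) (Ham ?q N n) =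
      - lfsum (\<lambda>m. Var (i, a - m) * (\<Sum>j\<in>{1..N}. Const (kern ?q N i j m) * mode m (?g j)))"
  proof (rule bracket_Var_Lam_gradient[OF mode_Ham])
    fix j b assume "j \<in> {1..N}"
    then show "pderiv (j, b) (Ham ?q N n) = - mode (- b) (vgrad q N n j)"
      unfolding pderiv_Ham[OF N n] by (rule if_P)
  next
    fix j b assume "j \<notin> {1..N}"
    then show "pderiv (j, b) (Ham ?q N n) = 0"
      unfolding pderiv_Ham[OF N n] by (rule if_not_P)
  qed
  also have "\<dots> = - mode a ((?A i - ?A (Suc i)) * Lam i)"
    unfolding sum unfolding mode_mult mode_Lam by (simp only: mult.commute)
  also have "\<dots> = mode a (Lam i * (?A (Suc i) - ?A i))"
    unfolding mode_minus[symmetric] by (simp add: algebra_simps)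
  finally show ?thesis .
qed

text \<open>Both terms of the Lax equation pair with the gradient to traces of
  \<open>P\<^sub>k\<^sup>n (P\<^sub>k\<^sup>m)\<^sub>+\<close>, for neighbouring values of \<open>k\<close>, so the sum over \<open>k\<close> telescopes.\<close>

lemma sum_vgrad_flow:
  assumes N: "0 < N"
  shows "(\<Sum>k\<in>{1..N}. mode 0 (vgrad q N n k * (Lam k * (res q N m (Suc k) - res q N m k)))) = 0"
proof -
  interpret trace_derivation "\<lambda>R. mode 0 (at_q (cf R 0) q)" "skew_map (euler_fam undefined)"
    by (rule trace_derivation_at)
  let ?tr = "\<lambda>R. mode 0 (at_q (cf R 0) q)"
  let ?Q = "\<lambda>k. skew_pos (Lroot N k ^ m)"
  let ?t = "\<lambda>k. ?tr (Lroot N k ^ n * ?Q k)"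
  have "mode 0 (vgrad q N n k * (Lam k * (res q N m (Suc k) - res q N m k))) = - (?t (Suc k) - ?t k)"
    if k: "k \<in> {1..N}" for k
  proof -
    have "- mode 0 (vgrad q N n k * (Lam k * (res q N m (Suc k) - res q N m k))) =
        ?tr (grad N n k * monom (- flow N m k) 0)"
      by (simp add: cf_mult_monom flow_def vgrad_def res_def cyc_id[OF k] mode_minus)
    also have "\<dots> = ?tr (grad N n k * fac N k * ?Q (Suc k)) - ?tr ((grad N n k * ?Q k) * fac N k)"
      unfolding lax_flow[OF N, symmetric] by (simp add: right_diff_distrib mode_diff mult.assoc)
    \<comment> \<open>Cyclicity brings \<open>fac N k\<close> to the left of
      \<open>grad N n k\<close>, where they combine to a power of the root.\<close>
    also have "?tr ((grad N n k * ?Q k) * fac N k) = ?t k"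
      by (subst tr_commute) (simp add: fac_grad flip: mult.assoc)
    finally show ?thesis unfolding grad_fac[OF N] by (metis minus_minus)
  qed
  then have "(\<Sum>k\<in>{1..N}. mode 0 (vgrad q N n k * (Lam k * (res q N m (Suc k) - res q N m k)))) =
      - (\<Sum>k\<in>{1..<Suc N}. ?t (Suc k) - ?t k)"
    unfolding sum_negf[symmetric] by (intro sum.cong) auto
  also have "\<dots> = - (?t (Suc N) - ?t 1)" by (subst sum_Suc_diff') auto
  also have "\<dots> = 0" using Lroot_add_self[of N 1] by simp
  finally show ?thesis .
qed

text \<open>The chain rule pairs the gradient of one hamiltonian with the flow of the other; the sum
  over \<open>b\<close> assembles into \<open>mode 0\<close> of a product, and
  \<open>sum_vgrad_flow\<close> applies.\<close>

lemma bracket_Ham_Ham: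
  assumes N: "0 < N" and n: "0 < n" and m: "0 < m"
  shows "bracket (Rep_generic q) N (Ham (Rep_generic q) N n) (Ham (Rep_generic q) N m) = 0"
proof -
  let ?q = "Rep_generic q"
  let ?u = "\<lambda>k. Lam k * (res q N m (Suc k) - res q N m k)"
  have "bracket ?q N (Ham ?q N n) (Ham ?q N m) =
      (\<Sum>k\<in>{1..N}. lfsum (\<lambda>b. pderiv (k, b) (Ham ?q N n) * bracket ?q N (Var (k, b)) (Ham ?q N m)))"
    unfolding bracket_expand(1)[OF mode_Ham mode_Ham]
    by (rule lfsum_var[OF bracket_expand(2)[OF mode_Ham mode_Ham]]) (auto simp: pderiv_Ham[OF N n])
  also have "\<dots> = (\<Sum>k\<in>{1..N}. - mode 0 (vgrad q N n k * ?u k))"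
  proof (rule sum.cong[OF refl])
    fix k assume k: "k \<in> {1..N}"
    have "pderiv (k, b) (Ham ?q N n) * bracket ?q N (Var (k, b)) (Ham ?q N m) =
        - (mode (- b) (vgrad q N n k) * mode (0 + b) (?u k))" for b
      using k by (simp add: pderiv_Ham[OF N n] bracket_Var_Ham[OF N m k])
    then show "lfsum (\<lambda>b. pderiv (k, b) (Ham ?q N n) * bracket ?q N (Var (k, b)) (Ham ?q N m)) =
        - mode 0 (vgrad q N n k * ?u k)"
      by (simp only: lfsum_minus mode_mult')
  qed
  also have "\<dots> = 0" by (simp only: sum_negf sum_vgrad_flow[OF N] minus_zero)
  finally show ?thesis .
qed

text \<open>Each row of \<open>Lmat\<close> has one nonzero entry and the powers of
  \<open>Pmat\<close> are diagonal, so both matrix products have a single term, and the scalar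
  identity \<open>lax_flow\<close> remains.\<close>

lemma mat_commutator_Lmat:
  assumes N: "0 < N" and i: "i \<in> {1..N}" and j: "j \<in> {1..N}"
  shows "mat_commutator (Rep_generic q) N (Lmat N)
      (mat_pos (mat_pow (Rep_generic q) N (Pmat (Rep_generic q) N) n)) i j =
    (if j = cyc N (i + 1) then op_fun (- (Lam i * (res q N n (Suc i) - res q N n i))) else op_fun 0)"
proof -
  let ?q = "Rep_generic q" and ?c = "cyc N (i + 1)"
  let ?B = "mat_pos (mat_pow ?q N (Pmat ?q N) n)"
  have pos0: "op_pos (\<lambda>_. 0) = (\<lambda>_. 0)" by (auto simp: op_pos_def)
  have B: "?B k l = (if k = l then op_at q (skew_pos (Lroot N k ^ n)) else (\<lambda>_. 0))" if "k \<in> {1..N}" for k l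
    using that by (auto simp: mat_pos_def Pmat_def mat_pow_diag pos0 Pop_eq_root[OF N] op_at_pos op_at_power)
  have c: "?c \<in> {1..N}" by (rule cyc_bounds[OF N])
  have L: "Lmat N i k = (if k = ?c then op_at q (fac N i) else (\<lambda>_. 0))" for k
    by (simp add: Lmat_def op_at_fac cyc_id[OF i])
  have "mat_mult ?q N (Lmat N) ?B i j m =
      (\<Sum>k\<in>{1..N}. if k = ?c then op_mult ?q (op_at q (fac N i)) (?B ?c j) m else 0)" for m
    unfolding mat_mult_def by (rule sum.cong) (auto simp: L)
  then have LB: "mat_mult ?q N (Lmat N) ?B i j m = op_mult ?q (op_at q (fac N i)) (?B ?c j) m" for m
    using c by simp
  have "mat_mult ?q N ?B (Lmat N) i j m =
      (\<Sum>k\<in>{1..N}. if k = i then op_mult ?q (?B i i) (Lmat N i j) m else 0)" for m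
    unfolding mat_mult_def by (rule sum.cong) (auto simp: B[OF i])
  then have BL: "mat_mult ?q N ?B (Lmat N) i j m = op_mult ?q (?B i i) (Lmat N i j) m" for m
    using i by simp
  show ?thesis
  proof (cases "j = ?c")
    case True
    have "mat_commutator ?q N (Lmat N) ?B i j =
        op_at q (fac N i * skew_pos (Lroot N (Suc i) ^ n) - skew_pos (Lroot N i ^ n) * fac N i)"
      unfolding mat_commutator_def LB BL
      using True c i by (simp add: B L op_at_diff op_at_mult Lroot_cyc)
    then show ?thesis
      using True by (simp add: lax_flow[OF N] op_at_monom_0 flow_def res_def cyc_id[OF i])
  next
    case False
    then show ?thesis unfolding mat_commutator_def LB BL using B[OF c] by (auto simp: L)
  qed
qed

text \<open>\<open>u\<close> stands for a candidate time derivative of the \<open>\<Lambda>\<close>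
  fields: the Lax equation and the hamiltonian equation, compared in each Fourier coefficient, are
  satisfied by the same \<open>u\<close>.\<close>

theorem theorem2:
  fixes q :: complex and N :: nat
  assumes "N \<ge> 2" and "q \<noteq> 0" and "\<And>k::nat. k \<ge> 1 \<Longrightarrow> q ^ k \<noteq> 1"
  shows "(\<forall>n\<ge>1. \<forall>u :: nat \<Rightarrow> lser.
            mat_eq N (dLmat N u)
              (mat_commutator q N (Lmat N) (mat_pos (mat_pow q N (Pmat q N) n)))
            \<longleftrightarrow> (\<forall>i\<in>{1..N}. \<forall>a. mode a (u i) = bracket q N (Var (i, a)) (Ham q N n)))
       \<and> (\<forall>n\<ge>1. \<forall>m\<ge>1. bracket q N (Ham q N n) (Ham q N m) = 0)"
proof -
  \<comment> \<open>Genericity makes \<open>q\<close> a point of the type \<open>generic\<close>,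
    over which the families are indexed.\<close>
  define G where "G = Abs_generic q"
  have q: "q = Rep_generic G" using assms(2,3) by (simp add: G_def Abs_generic_inverse)
  have N: "0 < N" using assms(1) by simp
  have "mat_eq N (dLmat N u) (mat_commutator q N (Lmat N) (mat_pos (mat_pow q N (Pmat q N) n)))
      \<longleftrightarrow> (\<forall>i\<in>{1..N}. \<forall>a. mode a (u i) = bracket q N (Var (i, a)) (Ham q N n))"
    if n: "n \<ge> 1" for n and u :: "nat \<Rightarrow> lser"
  proof -
    let ?v = "\<lambda>i. Lam i * (res G N n (Suc i) - res G N n i)"
    have op_fun_inj: "op_fun f = op_fun g \<longleftrightarrow> f = g" for f g
      by (metis op_fun_def)
    have "mat_eq N (dLmat N u) (mat_commutator q N (Lmat N) (mat_pos (mat_pow q N (Pmat q N) n)))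
        \<longleftrightarrow> (\<forall>i\<in>{1..N}. \<forall>j\<in>{1..N}. j = cyc N (i + 1) \<longrightarrow> u i = ?v i)"
      unfolding mat_eq_def q
      by (intro ball_cong refl) (simp add: mat_commutator_Lmat[OF N] dLmat_def op_fun_inj del: op_fun_0)
    \<comment> \<open>The column \<open>cyc N (i + 1)\<close> lies in the index range, so the
      condition on \<open>j\<close> is not vacuous.\<close>
    also have "\<dots> \<longleftrightarrow> (\<forall>i\<in>{1..N}. u i = ?v i)"
      using cyc_bounds[OF N] by blast
    also have "\<dots> \<longleftrightarrow> (\<forall>i\<in>{1..N}. \<forall>a. mode a (u i) = mode a (?v i))"
      by (intro ball_cong refl) (auto intro: mode_eqI)
    also have "\<dots> \<longleftrightarrow> (\<forall>i\<in>{1..N}. \<forall>a. mode a (u i) = bracket q N (Var (i, a)) (Ham q N n))"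
      using n by (intro ball_cong refl) (simp add: q bracket_Var_Ham[OF N])
    finally show ?thesis .
  qed
  moreover have "bracket q N (Ham q N n) (Ham q N m) = 0" if "n \<ge> 1" "m \<ge> 1" for n m
    using that by (simp add: q bracket_Ham_Ham[OF N])
  ultimately show ?thesis by blast
qed

end
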